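(* Let $[\,\cdot\,]$ be the $\mathbb{Q}(x,t,w)$-valued function on diagrams of colored singular links which equals the Aicardi–Juyumaya invariant $F$ on diagrams without singular crossings and which is extended to diagrams with singular crossings by the two (mutually consistent) skein relations (S1) and (S2) given in the context. If $\tilde D_1$ and $\tilde D_2$ are diagrams representing ambient isotopic colored singular links, then $[\tilde D_1]=[\tilde D_2]$. That is, $[\,\cdot\,]$ is an invariant of colored singular links.
   Context: **Colored (singular) links.** A singular link is an immersion in $\mathbb{R}^3$ of a disjoint union of finitely many circles whose only singularities are finitely many transverse double points; singular links are considered up to rigid-vertex ambient isotopy. All links here are oriented. The components are the images of the circles (a component passes straight through each double point). A diagram is a planar projection with classical crossings (over/under) and singular crossings (drawn as 4-valent vertices). Two diagrams represent ambient isotopic singular links iff they are related by planar isotopy and finitely many (oriented) extended Reidemeister moves: the classical moves $R1,R2,R3$; $R4$: a strand passing entirely over, or entirely under, a singular crossing is slid to the other side of it; $R5$: a classical crossing of the two strands adjacent to a singular crossing on one side is moved to the opposite side of the singular crossing. A classical link is a singular link without double points. A colored (singular) link is an oriented (singular) link together with a coloration, i.e. a function $\gamma$ from its set $C$ of components to a finite set of colors. Two colorations $\gamma,\gamma'$ are equivalent if there is a bijection $\beta:\gamma(C)\to\gamma'(C)$ with $\gamma'=\beta\circ\gamma$ (they induce the same partition of $C$). Colored singular links are ambient isotopic if the underlying singular links are, by an isotopy carrying one coloration to one equivalent to the other. An invariant takes the same value on ambient isotopic colored (singular) links. **Local notation.** Fix a disk in which a diagram consists of two strands, both directed upward, with arbitrary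 (possibly equal) colors $a,b$. The following denote diagrams identical outside the disk. Coloring unchanged: $X_+^{a,b}$ (positive classical crossing), $X_-^{a,b}$ (negative classical crossing), $V^{a,b}$ (singular crossing). With the colors $a$ and $b$ merged, i.e. all components of the diagram with color $a$ or $b$ are given one common color: $X_+$, $X_-$, $V$ (positive, negative, singular crossing) and $I$ (the two strands replaced by two disjoint upward arcs, the oriented smoothing). **The invariant $F$.** The Aicardi–Juyumaya invariant $F$ of colored (classical) links, with values in $\mathbb{Q}(x,t,w)$, exists and is uniquely determined by: (I) $F(\text{unknot})=1$; (II) $F(D\sqcup O)=\frac{1}{wx}F(D)$, where $D\sqcup O$ is the disjoint union of $D$ with an unknotted circle whose color differs from all colors of $D$; (III) $\frac1w F(X_+^{a,b})-wF(X_-^{a,b})=\left(1-\frac1t\right)F(I)+\left(\frac1w-\frac1{tw}\right)F(X_+)$ for all $a,b$. **The extension $[\,\cdot\,]$.** For a diagram $D$ of a colored classical link, $[D]=F(D)$. For diagrams with singular crossings, $[\,\cdot\,]$ is computed by applying at each singular crossing either one of (S1) $[V^{a,b}]=\frac1w[X_+^{a,b}]+\frac1t[I]+\frac1{tw}[X_+]$, (S2) $[V^{a,b}]=w[X_-^{a,b}]+t[I]+tw[X_-]$; the two choices give the same value because $F$ satisfies $\frac1wF(X_+^{a,b})-wF(X_-^{a,b})=\left(t-\frac1t\right)F(I)+twF(X_-)-\frac1{tw}F(X_+)$, a consequence of (III). *)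

theory Defs
  imports "HOL-Computational_Algebra.Computational_Algebra"
begin

text \<open>
  Diagrams are put in general position with respect to the height function and cut by
  horizontal lines into slices, read from bottom to top. Each slice contains exactly one local
  minimum (\<open>Cup\<close>), local maximum (\<open>Cap\<close>) or crossing (\<open>Cross\<close>); the number stored with it counts
  the strands to its left. Every diagram is planar isotopic to one of this form, and two such
  diagrams are planar isotopic iff they are related by the moves \<open>planar_move\<close> below.

  A strand meeting a cutting line carries a direction and a colour. A strand keeps its colour
  through all minima, maxima and crossings (it passes straight through a crossing, singular or
  not), so the colours of the strands amount to a function on the set of components. Colours are
  natural numbers; a diagram uses only finitely many of them.
\<close>

datatype dir = Up | Down

fun opp :: "dir \<Rightarrow> dir" where
  "opp Up = Down"
| "opp Down = Up"

type_synonym strand = "dir \<times> nat"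

text \<open>
  At a crossing one strand joins bottom left to top right, the other joins bottom right to top
  left. \<open>Over\<close> (\<open>Under\<close>) means that the former passes over (under) the latter, irrespective of
  the directions; \<open>Sing\<close> is a transverse double point.
\<close>

datatype crossing = Over | Under | Sing

datatype event = Cup nat dir nat | Cap nat | Cross crossing nat

type_synonym diagram = "event list"

text \<open>\<open>Cup i d c\<close> creates two strands of colour \<open>c\<close>, the left one with direction \<open>d\<close>.\<close>

inductive slice :: "strand list \<Rightarrow> event \<Rightarrow> strand list \<Rightarrow> bool" where
  "slice (l @ r) (Cup (length l) d c) (l @ (d, c) # (opp d, c) # r)"
| "slice (l @ (d, c) # (opp d, c) # r) (Cap (length l)) (l @ r)"
| "slice (l @ p # q # r) (Cross k (length l)) (l @ q # p # r)"

inductive tangle :: "strand list \<Rightarrow> diagram \<Rightarrow> strand list \<Rightarrow> bool" where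
  "tangle s [] s"
| "slice s e s' \<Longrightarrow> tangle s' D t \<Longrightarrow> tangle s (e # D) t"

definition is_diagram :: "diagram \<Rightarrow> bool" where
  "is_diagram D \<longleftrightarrow> tangle [] D []"

definition classical :: "diagram \<Rightarrow> bool" where
  "classical D \<longleftrightarrow> (\<forall>i. Cross Sing i \<notin> set D)"

text \<open>Every component has a minimum, so this is the set of all colours in use.\<close>

definition colors :: "diagram \<Rightarrow> nat set" where
  "colors D = {c. \<exists>i d. Cup i d c \<in> set D}"

fun recolor_event :: "(nat \<Rightarrow> nat) \<Rightarrow> event \<Rightarrow> event" where
  "recolor_event \<beta> (Cup i d c) = Cup i d (\<beta> c)"
| "recolor_event \<beta> (Cap i) = Cap i"
| "recolor_event \<beta> (Cross k i) = Cross k i"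

definition recolor :: "(nat \<Rightarrow> nat) \<Rightarrow> diagram \<Rightarrow> diagram" where
  "recolor \<beta> D = map (recolor_event \<beta>) D"

fun position :: "event \<Rightarrow> nat" where
  "position (Cup i d c) = i"
| "position (Cap i) = i"
| "position (Cross k i) = i"

fun width_in :: "event \<Rightarrow> nat" where
  "width_in (Cup i d c) = 0"
| "width_in (Cap i) = 2"
| "width_in (Cross k i) = 2"

fun width_out :: "event \<Rightarrow> nat" where
  "width_out (Cup i d c) = 2"
| "width_out (Cap i) = 0"
| "width_out (Cross k i) = 2"

fun shift :: "nat \<Rightarrow> event \<Rightarrow> event" where
  "shift n (Cup i d c) = Cup (n + i) d c"
| "shift n (Cap i) = Cap (n + i)"
| "shift n (Cross k i) = Cross k (n + i)"

text \<open>The picture of a crossing after a quarter turn.\<close>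

fun turn :: "crossing \<Rightarrow> crossing" where
  "turn Over = Under"
| "turn Under = Over"
| "turn Sing = Sing"

text \<open>
  Planar isotopy: exchanging the heights of two events side by side, cancelling a maximum
  against a neighbouring minimum, and moving a crossing through a maximum or minimum.
\<close>

inductive planar_move :: "diagram \<Rightarrow> diagram \<Rightarrow> bool" where
  exchange: "planar_move [e, shift (position e + width_out e) g] [shift (position e + width_in e) g, e]"
| snake_left: "planar_move [Cup 1 d c, Cap 0] []"
| snake_right: "planar_move [Cup 0 d c, Cap 1] []"
| turn_cap: "planar_move [Cross k 0, Cap 1] [Cross (turn k) 1, Cap 0]"
| turn_cup: "planar_move [Cup 1 d c, Cross k 0] [Cup 0 d c, Cross (turn k) 1]"

text \<open>
  The extended Reidemeister moves, for all directions of the strands. In \<open>R3\<close> and \<open>R4\<close> the bottom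
  strands \<open>p, q, r\<close> cross pairwise: \<open>k\<close>, \<open>l\<close> and \<open>m\<close> are the crossings of \<open>p, q\<close>, of \<open>p, r\<close> and of
  \<open>q, r\<close>. For classical crossings the condition \<open>l = k \<or> l = m\<close> excludes exactly the two cyclic
  patterns. In the three cases of \<open>R4\<close> the strand passing entirely over or entirely under the
  double point is \<open>r\<close>, \<open>p\<close> and \<open>q\<close> respectively.
\<close>

inductive reidemeister_move :: "diagram \<Rightarrow> diagram \<Rightarrow> bool" where
  R1_right: "k \<noteq> Sing \<Longrightarrow> reidemeister_move [Cup 1 d c, Cross k 0, Cap 1] []"
| R1_left: "k \<noteq> Sing \<Longrightarrow> reidemeister_move [Cup 0 d c, Cross k 1, Cap 0] []"
| R2: "k \<noteq> Sing \<Longrightarrow> reidemeister_move [Cross k 0, Cross (turn k) 0] []"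
| R3: "k \<noteq> Sing \<Longrightarrow> l \<noteq> Sing \<Longrightarrow> m \<noteq> Sing \<Longrightarrow> l = k \<or> l = m \<Longrightarrow>
    reidemeister_move [Cross k 0, Cross l 1, Cross m 0] [Cross m 1, Cross l 0, Cross k 1]"
| R4_r: "k \<noteq> Sing \<Longrightarrow>
    reidemeister_move [Cross Sing 0, Cross k 1, Cross k 0] [Cross k 1, Cross k 0, Cross Sing 1]"
| R4_p: "k \<noteq> Sing \<Longrightarrow>
    reidemeister_move [Cross k 0, Cross k 1, Cross Sing 0] [Cross Sing 1, Cross k 0, Cross k 1]"
| R4_q: "k \<noteq> Sing \<Longrightarrow>
    reidemeister_move [Cross k 0, Cross Sing 1, Cross (turn k) 0]
                      [Cross (turn k) 1, Cross Sing 0, Cross k 1]"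
| R5: "k \<noteq> Sing \<Longrightarrow> reidemeister_move [Cross Sing 0, Cross k 0] [Cross k 0, Cross Sing 0]"

definition move :: "diagram \<Rightarrow> diagram \<Rightarrow> bool" where
  "move D D' \<longleftrightarrow> (\<exists>A P Q B n s t.
     (planar_move P Q \<or> reidemeister_move P Q) \<and>
     tangle [] A s \<and> tangle s (map (shift n) P) t \<and> tangle s (map (shift n) Q) t \<and> tangle t B [] \<and>
     D = A @ map (shift n) P @ B \<and> D' = A @ map (shift n) Q @ B)"

text \<open>
  Moves carry the colours along, so the colorations are compared up to a bijection \<open>\<beta>\<close> between
  the sets of colours in use.
\<close>

definition isotopic :: "diagram \<Rightarrow> diagram \<Rightarrow> bool" where
  "isotopic D D' \<longleftrightarrow> is_diagram D \<and> is_diagram D' \<and>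
     (\<exists>\<beta>. inj_on \<beta> (colors D) \<and> equivclp move (recolor \<beta> D) D')"

text \<open>
  The field of rational functions over the rationals in \<open>x\<close>, \<open>t\<close>, \<open>w\<close>: polynomials in \<open>w\<close> whose
  coefficients are polynomials in \<open>t\<close> whose coefficients are polynomials in \<open>x\<close>.
\<close>

type_synonym ratfun = "rat poly poly poly fract"

definition var_x :: ratfun where "var_x = Fract [:[:[:0, 1:]:]:] 1"
definition var_t :: ratfun where "var_t = Fract [:[:0, 1:]:] 1"
definition var_w :: ratfun where "var_w = Fract [:0, 1:] 1"

text \<open>
  A crossing site: above \<open>A\<close> and below \<open>B\<close> there is room for a crossing at position \<open>i\<close>. The strand
  from bottom left to top right has direction \<open>d\<close> and colour \<open>a\<close>, the strand from bottom right to
  top left has direction \<open>e\<close> and colour \<open>b\<close>. Directions are arbitrary, as sliced diagrams contain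
  rotated pictures of crossings of two upward strands: for \<open>d \<noteq> e\<close> they are turned by a quarter,
  which interchanges \<open>Over\<close> and \<open>Under\<close> and makes the oriented smoothing a maximum below a minimum.
\<close>

datatype site = Site diagram nat diagram dir dir nat nat

fun is_site :: "site \<Rightarrow> bool" where
  "is_site (Site A i B d e a b) \<longleftrightarrow>
     (\<exists>l r. length l = i \<and> tangle [] A (l @ (d, a) # (e, b) # r) \<and>
            tangle (l @ (e, b) # (d, a) # r) B [])"

definition positive :: "dir \<Rightarrow> dir \<Rightarrow> crossing" where
  "positive d e = (if d = e then Over else Under)"

definition negative :: "dir \<Rightarrow> dir \<Rightarrow> crossing" where
  "negative d e = (if d = e then Under else Over)"

fun X_plus :: "site \<Rightarrow> diagram" where
  "X_plus (Site A i B d e a b) = A @ [Cross (positive d e) i] @ B"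

fun X_minus :: "site \<Rightarrow> diagram" where
  "X_minus (Site A i B d e a b) = A @ [Cross (negative d e) i] @ B"

fun V_sing :: "site \<Rightarrow> diagram" where
  "V_sing (Site A i B d e a b) = A @ [Cross Sing i] @ B"

fun merge_colors :: "site \<Rightarrow> diagram \<Rightarrow> diagram" where
  "merge_colors (Site A i B d e a b) D = recolor (\<lambda>c. if c = b then a else c) D"

fun I_smooth :: "site \<Rightarrow> diagram" where
  "I_smooth (Site A i B d e a b) =
     merge_colors (Site A i B d e a b) (A @ (if d = e then [] else [Cap i, Cup i e a]) @ B)"

definition circle :: "dir \<Rightarrow> nat \<Rightarrow> diagram" where
  "circle d c = [Cup 0 d c, Cap 0]"

definition AJ_invariant :: "(diagram \<Rightarrow> ratfun) \<Rightarrow> bool" where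
  "AJ_invariant F \<longleftrightarrow>
     (\<forall>D D'. classical D \<longrightarrow> classical D' \<longrightarrow> isotopic D D' \<longrightarrow> F D = F D') \<and>
     (\<forall>d c. F (circle d c) = 1) \<and>
     (\<forall>D d c. is_diagram D \<longrightarrow> classical D \<longrightarrow> c \<notin> colors D \<longrightarrow>
        F (D @ circle d c) = 1 / (var_w * var_x) * F D) \<and>
     (\<forall>S. is_site S \<longrightarrow> classical (X_plus S) \<longrightarrow>
        1 / var_w * F (X_plus S) - var_w * F (X_minus S)
          = (1 - 1 / var_t) * F (I_smooth S) + (1 / var_w - 1 / (var_t * var_w)) * F (merge_colors S (X_plus S)))"

definition skein_extension :: "(diagram \<Rightarrow> ratfun) \<Rightarrow> (diagram \<Rightarrow> ratfun) \<Rightarrow> bool" where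
  "skein_extension F br \<longleftrightarrow>
     (\<forall>D. is_diagram D \<longrightarrow> classical D \<longrightarrow> br D = F D) \<and>
     (\<forall>S. is_site S \<longrightarrow>
        br (V_sing S) = 1 / var_w * br (X_plus S) + 1 / var_t * br (I_smooth S)
                     + 1 / (var_t * var_w) * br (merge_colors S (X_plus S))) \<and>
     (\<forall>S. is_site S \<longrightarrow>
        br (V_sing S) = var_w * br (X_minus S) + var_t * br (I_smooth S)
                     + var_t * var_w * br (merge_colors S (X_minus S)))"

end

theory Submission
  imports Defs
begin

text \<open>
  Induction on the number of double points. Without double points, \<open>br\<close> is the invariant \<open>F\<close>.
  Otherwise every move can be accompanied by the resolution of one double point before and after
  it: a double point away from the move is resolved in place, and for a move involving one, the
  corresponding resolutions of the two sides are isotopic by moves with fewer double points.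
  The smoothings on the two sides may merge the same two colours into different ones of them, which
  is why invariance under injective recolouring is established first.
\<close>

section \<open>Typing of sliced tangles\<close>

text \<open>The resolutions of the two sides of a move are in general joined by several moves, so
  the induction hypothesis has to cover whole chains of moves. These chains are built locally, for
  tangles with arbitrary boundary words, and carried into a diagram by contexts, shifts and
  recolourings. The coefficients of (S1) and of (S2) do not depend on the site. Hence only the
  resolved crossings and the merged smoothings of the two sides have to be matched; the merged
  crossings follow by recolouring. Either relation may be used, provided it is the same one on both
  sides; \<open>R5\<close> takes the one whose crossing cancels against its classical crossing. As
  all directions occur, an oriented smoothing is either two upright arcs or a maximum below a
  minimum. The second form shapes most of the work: its extrema have to slide past a strand for
  \<open>R4\<close> and to be untwisted by \<open>R1\<close> for \<open>R5\<close>, and a quarter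
  turn of a double point exchanges the two forms.\<close>

lemma slice_Cup: "slice s (Cup i d c) t \<longleftrightarrow>
    (\<exists>l r. s = l @ r \<and> length l = i \<and> t = l @ (d, c) # (opp d, c) # r)"
  by (auto elim!: slice.cases intro: slice.intros)

lemma slice_Cap: "slice s (Cap i) t \<longleftrightarrow>
    (\<exists>l d c r. s = l @ (d, c) # (opp d, c) # r \<and> length l = i \<and> t = l @ r)"
  by (auto elim!: slice.cases intro: slice.intros)

lemma slice_Cross: "slice s (Cross k i) t \<longleftrightarrow>
    (\<exists>l p q r. s = l @ p # q # r \<and> length l = i \<and> t = l @ q # p # r)"
  by (blast elim: slice.cases intro: slice.intros)

lemmas slice_iff = slice_Cup slice_Cap slice_Cross

lemma append_eq_append_length:
  "l @ x = l' @ y \<Longrightarrow> length l' = length l + i \<Longrightarrow> \<exists>m. l' = l @ m \<and> x = m @ y \<and> length m = i"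
  by (auto simp: append_eq_append_conv2)

text \<open>Positions count strands from the left, so an event shifted by \<open>length l\<close>
  cannot reach the strands \<open>l\<close>. This equivalence cuts a shifted pattern free from
  everything to its left.\<close>

lemma slice_append:
  "slice (l @ x) (shift (length l) e) t \<longleftrightarrow> (\<exists>x'. t = l @ x' \<and> slice x e x')"
proof
  assume "slice (l @ x) (shift (length l) e) t"
  then show "\<exists>x'. t = l @ x' \<and> slice x e x'"
    by (cases e) (auto simp: slice_iff dest!: append_eq_append_length, blast+)
next
  assume "\<exists>x'. t = l @ x' \<and> slice x e x'"
  then obtain x' where "t = l @ x'" "slice x e x'"
    by blast
  then show "slice (l @ x) (shift (length l) e) t"
    by (cases e) (auto simp: slice_iff, (metis append_assoc length_append)+)
qed

lemma slice_length: "slice s e t \<Longrightarrow> position e \<le> length s"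
  by (cases e) (auto simp: slice_iff)

lemma slice_0:
  "slice s (Cup 0 d c) t \<longleftrightarrow> t = (d, c) # (opp d, c) # s"
  "slice s (Cap 0) t \<longleftrightarrow> (\<exists>d c. s = (d, c) # (opp d, c) # t)"
  "slice s (Cross k 0) t \<longleftrightarrow> (\<exists>p q r. s = p # q # r \<and> t = q # p # r)"
  by (auto simp: slice_iff)

lemma slice_Suc:
  assumes "position e = Suc i"
  shows "slice s e t \<longleftrightarrow> (\<exists>p s' t'. s = p # s' \<and> t = p # t' \<and> slice s' (case e of
    Cup _ d c \<Rightarrow> Cup i d c | Cap _ \<Rightarrow> Cap i | Cross k _ \<Rightarrow> Cross k i) t')"
  (is "_ \<longleftrightarrow> (\<exists>p s' t'. _ \<and> _ \<and> slice s' ?e t')")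
proof -
  have e: "e = shift 1 ?e"
    using assms by (cases e) auto
  show ?thesis
  proof (cases s)
    case Nil
    then show ?thesis
      using slice_length[of s e t] assms by auto
  next
    case (Cons p s')
    then show ?thesis
      using slice_append[of "[p]" s' ?e t] e by auto
  qed
qed

text \<open>Together with \<open>slice_0\<close> these rules let the simplifier compute the boundary
  words of concrete words of events, peeling off one strand at a time.\<close>

lemma slice_Suc_simps:
  "slice s (Cup (Suc i) d c) t \<longleftrightarrow> (\<exists>p s' t'. s = p # s' \<and> t = p # t' \<and> slice s' (Cup i d c) t')"
  "slice s (Cap (Suc i)) t \<longleftrightarrow> (\<exists>p s' t'. s = p # s' \<and> t = p # t' \<and> slice s' (Cap i) t')"
  "slice s (Cross k (Suc i)) t \<longleftrightarrow> (\<exists>p s' t'. s = p # s' \<and> t = p # t' \<and> slice s' (Cross k i) t')"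
  by (subst slice_Suc[where i = i]; simp)+

text \<open>The strands to the right stay variable as \<open>v'\<close>, since in an exchange of
  heights another event takes place among them.\<close>

lemma slice_local:
  assumes "slice s e t"
  obtains u m m' v where "s = u @ m @ v" "t = u @ m' @ v" "length u = position e"
    "length m = width_in e" "length m' = width_out e" "\<And>v'. slice (u @ m @ v') e (u @ m' @ v')"
proof (cases e)
  case (Cup i d c)
  then obtain u v where "s = u @ v" "length u = i" "t = u @ (d, c) # (opp d, c) # v"
    using assms by (auto simp: slice_Cup)
  then show thesis
    using that[of u "[]" v "[(d, c), (opp d, c)]"] Cup by (auto simp: slice_Cup)
next
  case (Cap i)
  then obtain u d c v where "s = u @ (d, c) # (opp d, c) # v" "length u = i" "t = u @ v"
    using assms by (auto simp: slice_Cap)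
  then show thesis
    using that[of u "[(d, c), (opp d, c)]" v "[]"] Cap by (auto simp: slice_Cap)
next
  case (Cross k i)
  then obtain u p q v where "s = u @ p # q # v" "length u = i" "t = u @ q # p # v"
    using assms by (auto simp: slice_Cross)
  then show thesis
    using that[of u "[p, q]" v "[q, p]"] Cross slice.intros(3)[of u p q _ k] by simp
qed

lemma tangle_Nil [simp]: "tangle s [] t \<longleftrightarrow> s = t"
  by (auto elim: tangle.cases intro: tangle.intros)

lemma tangle_Cons [simp]: "tangle s (e # D) t \<longleftrightarrow> (\<exists>s'. slice s e s' \<and> tangle s' D t)"
  by (auto elim: tangle.cases intro: tangle.intros)

lemma tangle_append [simp]: "tangle s (D @ E) t \<longleftrightarrow> (\<exists>s'. tangle s D s' \<and> tangle s' E t)"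
  by (induction D arbitrary: s) auto

lemma tangle_shift:
  "tangle (l @ x) (map (shift (length l)) D) t \<longleftrightarrow> (\<exists>x'. t = l @ x' \<and> tangle x D x')"
proof (induction D arbitrary: x)
  case (Cons e D)
  then show ?case
    by (simp add: slice_append) blast
qed auto

section \<open>Recolouring of strands and diagrams\<close>

definition recolor_strands :: "(nat \<Rightarrow> nat) \<Rightarrow> strand list \<Rightarrow> strand list" where
  "recolor_strands f s = map (map_prod id f) s"

lemma recolor_strands_simps [simp]:
  "recolor_strands f [] = []"
  "recolor_strands f ((d, c) # s) = (d, f c) # recolor_strands f s"
  "recolor_strands f (s @ t) = recolor_strands f s @ recolor_strands f t"
  "length (recolor_strands f s) = length s"
  by (auto simp: recolor_strands_def)

lemma recolor_simps [simp]:
  "recolor f [] = []"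
  "recolor f (e # D) = recolor_event f e # recolor f D"
  "recolor f (D @ E) = recolor f D @ recolor f E"
  by (auto simp: recolor_def)

lemma recolor_event_shift: "recolor_event f (shift n e) = shift n (recolor_event f e)"
  by (cases e) auto

lemma recolor_map_shift: "recolor f (map (shift n) D) = map (shift n) (recolor f D)"
  by (simp add: recolor_def recolor_event_shift)

lemma recolor_event_measures [simp]:
  "position (recolor_event f e) = position e"
  "width_in (recolor_event f e) = width_in e"
  "width_out (recolor_event f e) = width_out e"
  by (cases e; simp)+

lemma recolor_recolor: "recolor f (recolor g D) = recolor (f \<circ> g) D"
proof -
  have "recolor_event f (recolor_event g e) = recolor_event (f \<circ> g) e" for e
    by (cases e) auto
  then show ?thesis
    by (simp add: recolor_def)
qed

lemma recolor_id [simp]: "recolor id D = D"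
proof -
  have "recolor_event id e = e" for e
    by (cases e) auto
  then show ?thesis
    by (simp add: recolor_def map_idI)
qed

lemma recolor_cong: "(\<And>c. c \<in> colors D \<Longrightarrow> f c = g c) \<Longrightarrow> recolor f D = recolor g D"
proof -
  assume eq: "\<And>c. c \<in> colors D \<Longrightarrow> f c = g c"
  have "recolor_event f e = recolor_event g e" if "e \<in> set D" for e
  proof (cases e)
    case (Cup i d c)
    then have "c \<in> colors D"
      using that by (auto simp: colors_def)
    then show ?thesis
      using Cup eq by simp
  qed auto
  then show ?thesis
    by (simp add: recolor_def)
qed

lemma colors_append [simp]: "colors (D @ E) = colors D \<union> colors E"
  by (auto simp: colors_def)

lemma colors_Cons: "colors (e # D) = colors [e] \<union> colors D"
  by (auto simp: colors_def)

lemma colors_Cross: "colors [Cross k i] = {}"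
  by (auto simp: colors_def)

lemma colors_recolor: "colors (recolor f D) = f ` colors D"
proof (induction D)
  case Nil
  then show ?case by (auto simp: colors_def)
next
  case (Cons e D)
  have "colors [recolor_event f e] = f ` colors [e]"
    by (cases e) (auto simp: colors_def)
  then show ?case
    using Cons colors_Cons[of "recolor_event f e" "recolor f D"] colors_Cons[of e D]
    by (simp add: image_Un)
qed

text \<open>Of its two colours a maximum asks only that they be equal, which every function
  preserves; \<open>f\<close> is therefore arbitrary, as merging two colours requires.\<close>

lemma slice_recolor:
  "slice s e t \<Longrightarrow> slice (recolor_strands f s) (recolor_event f e) (recolor_strands f t)"
proof (induction rule: slice.induct)
  case (1 l r d c)
  then show ?case
    using slice.intros(1)[of "recolor_strands f l" "recolor_strands f r" d "f c"] by simp
next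
  case (2 l d c r)
  then show ?case
    using slice.intros(2)[of "recolor_strands f l" d "f c" "recolor_strands f r"] by simp
next
  case (3 l p q r k)
  then show ?case
    using slice.intros(3)[of "recolor_strands f l" "map_prod id f p" "map_prod id f q"
        "recolor_strands f r" k] by (cases p; cases q) simp
qed

lemma tangle_recolor:
  "tangle s D t \<Longrightarrow> tangle (recolor_strands f s) (recolor f D) (recolor_strands f t)"
  by (induction rule: tangle.induct) (auto dest: slice_recolor[where f = f])

lemma is_diagram_recolor: "is_diagram D \<Longrightarrow> is_diagram (recolor f D)"
  using tangle_recolor[of "[]" D "[]" f] by (simp add: is_diagram_def)

text \<open>Strands come from the lower boundary or from minima. In a diagram this puts both colours
  at a crossing among the colours in use, so that merging them introduces no new colour.\<close>

lemma strand_colors: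
  "tangle s D t \<Longrightarrow> snd ` set t \<subseteq> snd ` set s \<union> colors D"
proof (induction rule: tangle.induct)
  case (2 s e s' D t)
  from 2(1) have "snd ` set s' \<subseteq> snd ` set s \<union> colors [e]"
    by (cases rule: slice.cases) (auto simp: colors_def)
  then show ?case
    using 2 colors_Cons[of e D] by blast
qed auto

section \<open>Isotopy of tangles\<close>

text \<open>Resolutions of a pattern are compared before they are placed in a diagram, hence the
  free boundary words. Strands to the right of the pattern already belong to these words, so placing
  a tangle in a diagram only adds strands on the left and events below and above.\<close>

definition tangle_move :: "strand list \<Rightarrow> strand list \<Rightarrow> diagram \<Rightarrow> diagram \<Rightarrow> bool" where
  "tangle_move u v D D' \<longleftrightarrow> (\<exists>A P Q B n s t.
     (planar_move P Q \<or> reidemeister_move P Q) \<and>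
     tangle u A s \<and> tangle s (map (shift n) P) t \<and> tangle s (map (shift n) Q) t \<and> tangle t B v \<and>
     D = A @ map (shift n) P @ B \<and> D' = A @ map (shift n) Q @ B)"

abbreviation tangle_iso :: "strand list \<Rightarrow> strand list \<Rightarrow> diagram \<Rightarrow> diagram \<Rightarrow> bool" where
  "tangle_iso u v \<equiv> equivclp (tangle_move u v)"

lemma move_eq_tangle_move: "move = tangle_move [] []"
  by (intro ext) (simp add: move_def tangle_move_def)

lemma equivclp_map:
  assumes "equivclp r x y" and "\<And>x y. r x y \<Longrightarrow> r' (h x) (h y)"
  shows "equivclp r' (h x) (h y)"
  using assms(1)
proof (induction rule: equivclp_induct)
  case (step y z)
  then have "equivclp r' (h y) (h z)"
    using assms(2) by (meson equivclp_sym r_into_equivclp)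
  then show ?case
    using step equivclp_trans by metis
qed simp

lemma tangle_move_context:
  assumes "tangle_move s t D D'" "tangle u A s" "tangle t B v"
  shows "tangle_move u v (A @ D @ B) (A @ D' @ B)"
proof -
  obtain A' P Q B' n s' t' where *: "planar_move P Q \<or> reidemeister_move P Q"
    "tangle s A' s'" "tangle s' (map (shift n) P) t'" "tangle s' (map (shift n) Q) t'"
    "tangle t' B' t" "D = A' @ map (shift n) P @ B'" "D' = A' @ map (shift n) Q @ B'"
    using assms(1) unfolding tangle_move_def by blast
  show ?thesis
    unfolding tangle_move_def
    by (rule exI[of _ "A @ A'"], rule exI[of _ P], rule exI[of _ Q], rule exI[of _ "B' @ B"],
        rule exI[of _ n], rule exI[of _ s'], rule exI[of _ t']) (use * assms in auto)
qed

lemma tangle_iso_context: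
  assumes "tangle_iso s t D D'" "tangle u A s" "tangle t B v"
  shows "tangle_iso u v (A @ D @ B) (A @ D' @ B)"
  using assms(1) by (rule equivclp_map) (rule tangle_move_context[OF _ assms(2,3)])

lemma shift_shift: "shift m (shift n e) = shift (m + n) e"
  by (cases e) auto

lemma tangle_move_shift:
  assumes "tangle_move x y D D'"
  shows "tangle_move (l @ x) (l @ y) (map (shift (length l)) D) (map (shift (length l)) D')"
proof -
  obtain A P Q B n s t where *: "planar_move P Q \<or> reidemeister_move P Q"
    "tangle x A s" "tangle s (map (shift n) P) t" "tangle s (map (shift n) Q) t"
    "tangle t B y" "D = A @ map (shift n) P @ B" "D' = A @ map (shift n) Q @ B"
    using assms unfolding tangle_move_def by blast
  have sh: "map (shift (length l)) (map (shift n) E) = map (shift (length l + n)) E" for E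
    by (simp add: shift_shift)
  have "tangle (l @ s) (map (shift (length l + n)) E) (l @ t)" if "tangle s (map (shift n) E) t" for E
    using that unfolding sh[symmetric] tangle_shift by blast
  note sh_tangle = this[OF *(3)] this[OF *(4)]
  show ?thesis
    unfolding tangle_move_def
    by (rule exI[of _ "map (shift (length l)) A"], rule exI[of _ P], rule exI[of _ Q],
        rule exI[of _ "map (shift (length l)) B"], rule exI[of _ "length l + n"],
        rule exI[of _ "l @ s"], rule exI[of _ "l @ t"])
      (use * sh sh_tangle in \<open>simp add: tangle_shift\<close>)
qed

lemma tangle_iso_shift:
  assumes "tangle_iso x y D D'"
  shows "tangle_iso (l @ x) (l @ y) (map (shift (length l)) D) (map (shift (length l)) D')"
  using assms by (rule equivclp_map) (rule tangle_move_shift)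

lemma planar_move_recolor: "planar_move P Q \<Longrightarrow> planar_move (recolor f P) (recolor f Q)"
proof (induction rule: planar_move.induct)
  case (exchange e g)
  then show ?case
    using planar_move.exchange[of "recolor_event f e" "recolor_event f g"]
    by (simp add: recolor_event_shift)
qed (simp add: planar_move.intros del: One_nat_def)+

lemma reidemeister_move_recolor:
  "reidemeister_move P Q \<Longrightarrow> reidemeister_move (recolor f P) (recolor f Q)"
  by (induction rule: reidemeister_move.induct) (simp add: reidemeister_move.intros del: One_nat_def)+

lemma tangle_move_recolor:
  assumes "tangle_move u v D D'"
  shows "tangle_move (recolor_strands f u) (recolor_strands f v) (recolor f D) (recolor f D')"
proof -
  obtain A P Q B n s t where *: "planar_move P Q \<or> reidemeister_move P Q"
    "tangle u A s" "tangle s (map (shift n) P) t" "tangle s (map (shift n) Q) t"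
    "tangle t B v" "D = A @ map (shift n) P @ B" "D' = A @ map (shift n) Q @ B"
    using assms unfolding tangle_move_def by blast
  have pq: "planar_move (recolor f P) (recolor f Q) \<or> reidemeister_move (recolor f P) (recolor f Q)"
    using *(1) planar_move_recolor reidemeister_move_recolor by blast
  show ?thesis
    unfolding tangle_move_def
    by (rule exI[of _ "recolor f A"], rule exI[of _ "recolor f P"], rule exI[of _ "recolor f Q"],
        rule exI[of _ "recolor f B"], rule exI[of _ n],
        rule exI[of _ "recolor_strands f s"], rule exI[of _ "recolor_strands f t"])
      (use pq *(6,7) *(2-5)[THEN tangle_recolor[where f = f]] in \<open>simp add: recolor_map_shift\<close>)
qed

lemma tangle_iso_recolor:
  assumes "tangle_iso u v D D'"
  shows "tangle_iso (recolor_strands f u) (recolor_strands f v) (recolor f D) (recolor f D')"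
  using assms by (rule equivclp_map) (rule tangle_move_recolor)

section \<open>The number of double points\<close>

fun is_sing :: "event \<Rightarrow> bool" where
  "is_sing (Cross Sing i) = True"
| "is_sing _ = False"

definition sing_count :: "diagram \<Rightarrow> nat" where
  "sing_count D = length (filter is_sing D)"

lemma sing_count_simps [simp]:
  "sing_count [] = 0"
  "sing_count (e # D) = (if is_sing e then 1 else 0) + sing_count D"
  "sing_count (D @ E) = sing_count D + sing_count E"
  by (auto simp: sing_count_def)

lemma is_sing_iff: "is_sing e \<longleftrightarrow> (\<exists>i. e = Cross Sing i)"
  by (cases e rule: is_sing.cases) auto

lemma is_sing_Cross [simp]: "is_sing (Cross k i) \<longleftrightarrow> k = Sing"
  by (cases k) auto

lemma is_sing_invariant [simp]:
  "is_sing (shift n e) = is_sing e" "is_sing (recolor_event f e) = is_sing e"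
  by (cases e; simp)+

lemma turn_eq_Sing [simp]: "turn k = Sing \<longleftrightarrow> k = Sing"
  by (cases k) auto

lemma sing_count_invariant [simp]:
  "sing_count (map (shift n) D) = sing_count D" "sing_count (recolor f D) = sing_count D"
  by (induction D) auto

lemma sing_count_eq_0: "sing_count D = 0 \<longleftrightarrow> classical D"
  by (auto simp: sing_count_def classical_def filter_empty_conv is_sing_iff)

text \<open>The two patterns of each move contain equally many double points, so the induction
  measure is constant along an isotopy.\<close>

lemma sing_count_move:
  assumes "move D D'"
  shows "sing_count D = sing_count D'"
proof -
  have "sing_count P = sing_count Q" if "planar_move P Q" for P Q
    using that by (induction rule: planar_move.induct) auto
  moreover have "sing_count P = sing_count Q" if "reidemeister_move P Q" for P Q
    using that by (induction rule: reidemeister_move.induct) auto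
  ultimately show ?thesis
    using assms by (auto simp: move_def)
qed

lemma sing_count_pos:
  assumes "sing_count D \<noteq> 0"
  obtains A i B where "D = A @ [Cross Sing i] @ B"
proof -
  obtain i where "Cross Sing i \<in> set D"
    using assms by (auto simp: sing_count_eq_0 classical_def)
  then show thesis
    using that split_list[of "Cross Sing i" D] by auto
qed

lemma move_is_diagram: "move D D' \<Longrightarrow> is_diagram D \<and> is_diagram D'"
  unfolding move_def is_diagram_def by (elim exE conjE) (simp, blast)

lemma equivclp_move_invariants:
  assumes "equivclp move D D'" "is_diagram D"
  shows "is_diagram D' \<and> sing_count D' = sing_count D"
  using assms(1)
  by (induction rule: equivclp_induct) (use assms(2) move_is_diagram sing_count_move in auto)


text \<open>The quantifiers of the premise are nested in the order in which the boundary words are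
  computed from below, so that \<open>tangle_simps\<close> can discharge it for concrete words. The
  second conclusion applies the move backwards.\<close>

lemma tangle_iso_step:
  assumes "planar_move P Q \<or> reidemeister_move P Q"
    and "\<exists>s. tangle u A s \<and> (\<exists>t. tangle s (map (shift n) P) t \<and> tangle s (map (shift n) Q) t \<and> tangle t B v)"
  shows "tangle_iso u v (A @ map (shift n) P @ B) (A @ map (shift n) Q @ B)"
    "tangle_iso u v (A @ map (shift n) Q @ B) (A @ map (shift n) P @ B)"
proof -
  show "tangle_iso u v (A @ map (shift n) P @ B) (A @ map (shift n) Q @ B)"
    using assms unfolding tangle_move_def by (intro r_into_equivclp) blast
  then show "tangle_iso u v (A @ map (shift n) Q @ B) (A @ map (shift n) P @ B)"
    by (rule equivclp_sym)
qed

lemma shift_0 [simp]: "shift 0 e = e"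
  by (cases e) auto

lemma map_shift_0 [simp]: "map (shift 0) D = D"
  by (simp add: map_idI)

lemma tangle_iso_move:
  assumes "planar_move P Q \<or> reidemeister_move P Q" "tangle u P v" "tangle u Q v"
  shows "tangle_iso u v P Q"
  using tangle_iso_step(1)[of P Q u "[]" 0 "[]" v] assms by simp

section \<open>Exchanging tangles that lie side by side\<close>

lemma slice_extend: "slice s e t \<Longrightarrow> slice (s @ r) e (t @ r)"
proof (induction rule: slice.induct)
  case (1 l r' d c)
  then show ?case
    using slice.intros(1)[of l "r' @ r" d c] by simp
next
  case (2 l d c r')
  then show ?case
    using slice.intros(2)[of l d c "r' @ r"] by simp
next
  case (3 l p q r' k)
  then show ?case
    using slice.intros(3)[of l p q "r' @ r" k] by simp
qed

lemma exchange_events: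
  assumes "slice s e t" "slice s' g t'"
  shows "tangle_iso (s @ s') (t @ t') [e, shift (length t) g] [shift (length s) g, e]"
proof -
  obtain u m m' v where s: "s = u @ m @ v" and t: "t = u @ m' @ v" and len: "length u = position e"
    "length m = width_in e" "length m' = width_out e"
    using slice_local[OF assms(1)] by metis
  \<comment> \<open>In the pattern of \<open>exchange\<close> positions of the second event count
    from the strands directly next to \<open>e\<close>; the offset \<open>length v\<close> skips the
    strands of \<open>s\<close> to the right of \<open>e\<close>.\<close>
  have "planar_move [e, shift (length t) g] [shift (length s) g, e]"
    using exchange[of e "shift (length v) g"] len by (simp add: s t shift_shift add.assoc)
  then show ?thesis
    using slice_extend[OF assms(1)] slice_append assms(2)
    by (intro tangle_iso_move) (simp_all, blast+)
qed

lemma exchange_event_tangle: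
  assumes "slice s e t" "tangle s' E t'"
  shows "tangle_iso (s @ s') (t @ t') (e # map (shift (length t)) E) (map (shift (length s)) E @ [e])"
  using assms(2)
proof (induction E arbitrary: s')
  case Nil
  then show ?case by simp
next
  case (Cons g E)
  then obtain s'' where g: "slice s' g s''" and E: "tangle s'' E t'"
    by auto
  have "tangle_iso (s @ s') (t @ t') (e # map (shift (length t)) (g # E))
      (shift (length s) g # e # map (shift (length t)) E)"
    using tangle_iso_context[OF exchange_events[OF assms(1) g], of "s @ s'" "[]"
        "map (shift (length t)) E" "t @ t'"] E by (simp add: tangle_shift)
  also have "tangle_iso (s @ s') (t @ t') \<dots> (shift (length s) g # map (shift (length s)) E @ [e])"
    using tangle_iso_context[OF Cons.IH[OF E], of "s @ s'" "[shift (length s) g]" "[]" "t @ t'"] g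
    by (simp add: slice_append)
  finally show ?case
    by simp
qed

text \<open>A smoothing consists of no event or of two, so moving it past a neighbour takes an
  exchange of words rather than of single events.\<close>

lemma exchange_tangles:
  assumes "tangle s D t" "tangle s' E t'"
  shows "tangle_iso (s @ s') (t @ t') (D @ map (shift (length t)) E) (map (shift (length s)) E @ D)"
  using assms(1)
proof (induction rule: tangle.induct)
  case (1 s)
  then show ?case by simp
next
  case (2 s e s1 D t)
  have ext: "tangle (s1 @ r) D (t @ r)" for r
    using 2(2) by (induction rule: tangle.induct) (auto intro: slice_extend)
  have "tangle_iso (s @ s') (t @ t') (e # D @ map (shift (length t)) E)
      (e # map (shift (length s1)) E @ D)"
    using tangle_iso_context[OF 2(3), of "s @ s'" "[e]" "[]" "t @ t'"] slice_extend[OF 2(1)] by simp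
  also have "tangle_iso (s @ s') (t @ t') \<dots> (map (shift (length s)) E @ e # D)"
    using tangle_iso_context[OF exchange_event_tangle[OF 2(1) assms(2)], of "s @ s'" "[]" D "t @ t'"] ext
    by simp
  finally show ?case
    by simp
qed

lemmas tangle_simps = slice_0 slice_Suc_simps

lemma neq_dir_iff: "d \<noteq> e \<longleftrightarrow> e = opp d"
  by (cases d; cases e) auto

lemma opp_opp [simp]: "opp (opp d) = d"
  by (cases d) auto

lemma opp_neq [simp]: "opp d \<noteq> d" "d \<noteq> opp d"
  by (cases d; simp)+

lemma turn_turn [simp]: "turn (turn k) = k"
  by (cases k) auto


section \<open>Sliding extrema past a strand, and untwisting them\<close>

text \<open>Moving one crossing through the extremum changes \<open>k\<close> into
  \<open>turn k\<close>, which then cancels the other crossing by \<open>R2\<close>. The four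
  versions serve the antiparallel smoothings in \<open>R4_r\<close> and \<open>R4_p\<close>.\<close>

lemma cup_under_strand_right:
  assumes "k \<noteq> Sing"
  shows "tangle_iso (p # s) (p # (d, c) # (opp d, c) # s)
    [Cup 0 d c, Cross k (Suc 0), Cross k 0] [Cup (Suc 0) d c]"
    (is "tangle_iso ?u ?v _ _")
proof -
  have "tangle_iso ?u ?v [Cup 0 d c, Cross k 1, Cross k 0] [Cup 1 d c, Cross (turn k) 0, Cross k 0]"
    using tangle_iso_step(2)[OF disjI1[OF turn_cup[of d c "turn k"]], of ?u "[]" 0 "[Cross k 0]" ?v]
    by (cases p) (simp add: tangle_simps)
  also have "tangle_iso ?u ?v \<dots> [Cup 1 d c]"
    using tangle_iso_step(1)[OF disjI2[OF R2[of "turn k"]], of ?u "[Cup 1 d c]" 0 "[]" ?v] assms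
    by (cases p) (simp add: tangle_simps)
  finally show ?thesis
    by simp
qed

lemma cup_under_strand_left:
  assumes "k \<noteq> Sing"
  shows "tangle_iso (p # s) ((d, c) # (opp d, c) # p # s)
    [Cup (Suc 0) d c, Cross k 0, Cross k (Suc 0)] [Cup 0 d c]"
    (is "tangle_iso ?u ?v _ _")
proof -
  have "tangle_iso ?u ?v [Cup 1 d c, Cross k 0, Cross k 1] [Cup 0 d c, Cross (turn k) 1, Cross k 1]"
    using tangle_iso_step(1)[OF disjI1[OF turn_cup[of d c k]], of ?u "[]" 0 "[Cross k 1]" ?v]
    by (cases p) (simp add: tangle_simps)
  also have "tangle_iso ?u ?v \<dots> [Cup 0 d c]"
    using tangle_iso_step(1)[OF disjI2[OF R2[of "turn k"]], of ?u "[Cup 0 d c]" 1 "[]" ?v] assms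
    by (cases p) (simp add: tangle_simps)
  finally show ?thesis
    by simp
qed

lemma cap_under_strand_right:
  assumes "k \<noteq> Sing"
  shows "tangle_iso ((d, c) # (opp d, c) # p # s) (p # s)
    [Cross k (Suc 0), Cross k 0, Cap (Suc 0)] [Cap 0]"
    (is "tangle_iso ?u ?v _ _")
proof -
  have "tangle_iso ?u ?v [Cross k 1, Cross k 0, Cap 1] [Cross k 1, Cross (turn k) 1, Cap 0]"
    using tangle_iso_step(1)[OF disjI1[OF turn_cap[of k]], of ?u "[Cross k 1]" 0 "[]" ?v]
    by (cases p) (simp add: tangle_simps)
  also have "tangle_iso ?u ?v \<dots> [Cap 0]"
    using tangle_iso_step(1)[OF disjI2[OF R2[of k]], of ?u "[]" 1 "[Cap 0]" ?v] assms
    by (cases p) (simp add: tangle_simps)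
  finally show ?thesis
    by simp
qed

lemma cap_under_strand_left:
  assumes "k \<noteq> Sing"
  shows "tangle_iso (p # (d, c) # (opp d, c) # s) (p # s)
    [Cross k 0, Cross k (Suc 0), Cap 0] [Cap (Suc 0)]"
    (is "tangle_iso ?u ?v _ _")
proof -
  have "tangle_iso ?u ?v [Cross k 0, Cross k 1, Cap 0] [Cross k 0, Cross (turn k) 0, Cap 1]"
    using tangle_iso_step(2)[OF disjI1[OF turn_cap[of "turn k"]], of ?u "[Cross k 0]" 0 "[]" ?v]
    by (cases p) (simp add: tangle_simps)
  also have "tangle_iso ?u ?v \<dots> [Cap 1]"
    using tangle_iso_step(1)[OF disjI2[OF R2[of k]], of ?u "[]" 0 "[Cap 1]" ?v] assms
    by (cases p) (simp add: tangle_simps)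
  finally show ?thesis
    by simp
qed

text \<open>\<open>R1\<close> twists a strand; inserting a zigzag next to the extremum turns a twisted extremum into it.\<close>

lemma twisted_cap:
  assumes "k \<noteq> Sing"
  shows "tangle_iso ((d, c) # (opp d, c) # s) s [Cross k 0, Cap 0] [Cap 0]"
    (is "tangle_iso ?u ?v _ _")
proof -
  let ?cup = "Cup 1 (opp d) c"
  have "tangle_iso ?u ?v [Cross k 0, Cap 0] [?cup, Cap 2, Cross k 0, Cap 0]"
    using tangle_iso_step(2)[OF disjI1[OF snake_right[of "opp d" c]],
        of ?u "[]" 1 "[Cross k 0, Cap 0]" ?v]
    by (simp add: tangle_simps numeral_2_eq_2)
  also have "tangle_iso ?u ?v \<dots> [?cup, Cross k 0, Cap 2, Cap 0]"
    using tangle_iso_step(2)[OF disjI1[OF exchange[of "Cross k 0" "Cap 0"]], of ?u "[?cup]" 0 "[Cap 0]" ?v]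
    by (simp add: tangle_simps numeral_2_eq_2)
  \<comment> \<open>Once the twisted maximum is the lower of the two maxima, it forms with the
    minimum of the zigzag the curl of \<open>R1_left\<close>, up to a turn of the crossing; the
    maximum of the zigzag survives.\<close>
  also have "tangle_iso ?u ?v \<dots> [?cup, Cross k 0, Cap 0, Cap 0]"
    using tangle_iso_step(2)[OF disjI1[OF exchange[of "Cap 0" "Cap 0"]], of ?u "[?cup, Cross k 0]" 0 "[]" ?v]
    by (simp add: tangle_simps numeral_2_eq_2)
  also have "tangle_iso ?u ?v \<dots> [Cup 0 (opp d) c, Cross (turn k) 1, Cap 0, Cap 0]"
    using tangle_iso_step(1)[OF disjI1[OF turn_cup[of "opp d" c k]], of ?u "[]" 0 "[Cap 0, Cap 0]" ?v]
    by (simp add: tangle_simps numeral_2_eq_2)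
  also have "tangle_iso ?u ?v \<dots> [Cap 0]"
    using tangle_iso_step(1)[OF disjI2[OF R1_left[of "turn k" "opp d" c]], of ?u "[]" 0 "[Cap 0]" ?v] assms
    by (simp add: tangle_simps numeral_2_eq_2)
  finally show ?thesis .
qed

lemma twisted_cup:
  assumes "k \<noteq> Sing"
  shows "tangle_iso s ((d, c) # (opp d, c) # s) [Cup 0 (opp d) c, Cross k 0] [Cup 0 d c]"
    (is "tangle_iso ?u ?v _ _")
proof -
  let ?cup = "Cup 0 (opp d) c"
  have "tangle_iso ?u ?v [?cup, Cross k 0] [?cup, Cross k 0, Cup 2 d c, Cap 1]"
    using tangle_iso_step(2)[OF disjI1[OF snake_left[of d c]], of ?u "[?cup, Cross k 0]" 1 "[]" ?v]
    by (simp add: tangle_simps numeral_2_eq_2)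
  also have "tangle_iso ?u ?v \<dots> [?cup, Cup 2 d c, Cross k 0, Cap 1]"
    using tangle_iso_step(1)[OF disjI1[OF exchange[of "Cross k 0" "Cup 0 d c"]], of ?u "[?cup]" 0 "[Cap 1]" ?v]
    by (simp add: tangle_simps numeral_2_eq_2)
  \<comment> \<open>The minimum of the zigzag goes to the bottom and survives as the untwisted
    minimum; the twisted one closes up to a curl with the maximum of the zigzag.\<close>
  also have "tangle_iso ?u ?v \<dots> [Cup 0 d c, ?cup, Cross k 0, Cap 1]"
    using tangle_iso_step(1)[OF disjI1[OF exchange[of ?cup "Cup 0 d c"]], of ?u "[]" 0 "[Cross k 0, Cap 1]" ?v]
    by (simp add: tangle_simps numeral_2_eq_2)
  also have "tangle_iso ?u ?v \<dots> [Cup 0 d c, ?cup, Cross (turn k) 1, Cap 0]"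
    using tangle_iso_step(1)[OF disjI1[OF turn_cap[of k]], of ?u "[Cup 0 d c, ?cup]" 0 "[]" ?v]
    by (simp add: tangle_simps numeral_2_eq_2)
  also have "tangle_iso ?u ?v \<dots> [Cup 0 d c]"
    using tangle_iso_step(1)[OF disjI2[OF R1_left[of "turn k" "opp d" c]], of ?u "[Cup 0 d c]" 0 "[]" ?v] assms
    by (simp add: tangle_simps numeral_2_eq_2)
  finally show ?thesis .
qed

section \<open>Resolving a double point\<close>

text \<open>The local part of \<open>I_smooth\<close>. It fits between the strands of the site only
  after both have been given the colour \<open>a\<close>, so it is always used under
  \<open>recolor (merge a b)\<close>. The minimum has direction \<open>e\<close> because that is the
  direction of the left strand above the site.\<close>

definition smoothing :: "nat \<Rightarrow> dir \<Rightarrow> dir \<Rightarrow> nat \<Rightarrow> diagram" where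
  "smoothing i d e a = (if d = e then [] else [Cap i, Cup i e a])"

lemma smoothing_tangle:
  "tangle (l @ (d, a) # (e, a) # r) (smoothing (length l) d e a) (l @ (e, a) # (d, a) # r)"
  using slice.intros(1)[of l r e a] slice.intros(2)[of l d a r]
  by (cases "d = e") (auto simp: smoothing_def neq_dir_iff)

lemma smoothing_recolor [simp]: "recolor f (smoothing i d e a) = smoothing i d e (f a)"
  by (simp add: smoothing_def)

lemma smoothing_shift [simp]: "map (shift n) (smoothing i d e a) = smoothing (n + i) d e a"
  by (simp add: smoothing_def)

lemma sing_count_smoothing [simp]: "sing_count (smoothing i d e a) = 0"
  by (simp add: smoothing_def)

lemma colors_smoothing: "colors (smoothing i d e a) \<subseteq> {a}"
  by (auto simp: smoothing_def colors_def)

lemma signs_not_Sing [simp]: "positive d e \<noteq> Sing" "negative d e \<noteq> Sing"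
  by (auto simp: positive_def negative_def)

definition merge :: "nat \<Rightarrow> nat \<Rightarrow> nat \<Rightarrow> nat" where
  "merge a b c = (if c = b then a else c)"

lemma merge_simps [simp]: "merge a b a = a" "merge a b b = a"
  by (auto simp: merge_def)

text \<open>The condition \<open>is_site\<close> with free boundary words, for double points of
  tangles.\<close>

definition crossing_site :: "strand list \<Rightarrow> strand list \<Rightarrow> diagram \<Rightarrow> nat \<Rightarrow> diagram \<Rightarrow>
    dir \<Rightarrow> dir \<Rightarrow> nat \<Rightarrow> nat \<Rightarrow> bool" where
  "crossing_site u v A i B d e a b \<longleftrightarrow> (\<exists>l r. length l = i \<and>
     tangle u A (l @ (d, a) # (e, b) # r) \<and> tangle (l @ (e, b) # (d, a) # r) B v)"

lemma crossing_site_cross: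
  assumes "tangle u (A @ [Cross k i] @ B) v"
  obtains d e a b where "crossing_site u v A i B d e a b"
proof -
  obtain l p q r where "tangle u A (l @ p # q # r)" "length l = i" "tangle (l @ q # p # r) B v"
    using assms by (auto simp: slice_Cross)
  then show thesis
    using that unfolding crossing_site_def by (cases p; cases q) blast
qed

lemma crossing_site_tangle:
  assumes "crossing_site u v A i B d e a b"
  shows "tangle u (A @ [Cross k i] @ B) v"
  using assms slice.intros(3) unfolding crossing_site_def tangle_append tangle_Cons tangle_Nil by metis

lemma crossing_site_smoothing:
  assumes "crossing_site u v A i B d e a b"
  shows "tangle (recolor_strands (merge a b) u) (recolor (merge a b) (A @ smoothing i d e a @ B))
    (recolor_strands (merge a b) v)"
proof -
  obtain l r where l: "length l = i" and A: "tangle u A (l @ (d, a) # (e, b) # r)"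
    and B: "tangle (l @ (e, b) # (d, a) # r) B v"
    using assms unfolding crossing_site_def by blast
  show ?thesis
    using tangle_recolor[OF A, of "merge a b"] tangle_recolor[OF B, of "merge a b"]
      smoothing_tangle[of "recolor_strands (merge a b) l" d a e "recolor_strands (merge a b) r"] l
    by auto
qed

lemma crossing_site_recolor:
  assumes "crossing_site u v A i B d e a b"
  shows "crossing_site (recolor_strands f u) (recolor_strands f v) (recolor f A) i (recolor f B)
    d e (f a) (f b)"
proof -
  obtain l r where l: "length l = i" and A: "tangle u A (l @ (d, a) # (e, b) # r)"
    and B: "tangle (l @ (e, b) # (d, a) # r) B v"
    using assms unfolding crossing_site_def by blast
  then show ?thesis
    unfolding crossing_site_def using tangle_recolor[OF A, of f] tangle_recolor[OF B, of f]
    by (intro exI[of _ "recolor_strands f l"] exI[of _ "recolor_strands f r"]) simp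
qed

lemma crossing_site_context:
  assumes "crossing_site x y P i Q d e a b" "tangle u A (l @ x)" "tangle (l @ y) B v"
  shows "crossing_site u v (A @ map (shift (length l)) P) (length l + i)
    (map (shift (length l)) Q @ B) d e a b"
proof -
  obtain l' r where "length l' = i" "tangle x P (l' @ (d, a) # (e, b) # r)"
    "tangle (l' @ (e, b) # (d, a) # r) Q y"
    using assms(1) unfolding crossing_site_def by blast
  then have "tangle (l @ x) (map (shift (length l)) P) ((l @ l') @ (d, a) # (e, b) # r)"
    "tangle ((l @ l') @ (e, b) # (d, a) # r) (map (shift (length l)) Q) (l @ y)"
    "length (l @ l') = length l + i"
    by (simp_all add: tangle_shift)
  then show ?thesis
    using assms(2,3) unfolding crossing_site_def tangle_append by blast
qed

lemma crossing_site_colors: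
  assumes "crossing_site [] v A i B d e a b"
  shows "a \<in> colors A" "b \<in> colors A"
  using assms strand_colors[of "[]" A] unfolding crossing_site_def by fastforce+

lemma crossing_siteI:
  assumes "tangle u A (l @ (d, a) # (e, b) # r)" "tangle (l @ (e, b) # (d, a) # r) B v" "length l = i"
  shows "crossing_site u v A i B d e a b"
  using assms unfolding crossing_site_def by blast

text \<open>
  The second site may list the colours in the opposite order, because turning the picture
  interchanges the two strands.
\<close>

definition resolvable :: "strand list \<Rightarrow> strand list \<Rightarrow> diagram \<Rightarrow> diagram \<Rightarrow> bool" where
  "resolvable u v D D' \<longleftrightarrow> (\<exists>A i B A' i' B' d e a b d' e' a' b' \<sigma>.
     D = A @ [Cross Sing i] @ B \<and> D' = A' @ [Cross Sing i'] @ B' \<and>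
     crossing_site u v A i B d e a b \<and> crossing_site u v A' i' B' d' e' a' b' \<and>
     ((a', b') = (a, b) \<or> (a', b') = (b, a)) \<and> (\<sigma> = positive \<or> \<sigma> = negative) \<and>
     tangle_iso u v (A @ [Cross (\<sigma> d e) i] @ B) (A' @ [Cross (\<sigma> d' e') i'] @ B') \<and>
     tangle_iso (recolor_strands (merge a b) u) (recolor_strands (merge a b) v)
       (recolor (merge a b) (A @ smoothing i d e a @ B))
       (recolor (merge a b) (A' @ smoothing i' d' e' a' @ B')))"

lemma resolvableI:
  assumes "D = A @ [Cross Sing i] @ B" "D' = A' @ [Cross Sing i'] @ B'"
    and "crossing_site u v A i B d e a b" "crossing_site u v A' i' B' d' e' a' b'"
    and "(a', b') = (a, b) \<or> (a', b') = (b, a)" "\<sigma> = positive \<or> \<sigma> = negative"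
    and "tangle_iso u v (A @ [Cross (\<sigma> d e) i] @ B) (A' @ [Cross (\<sigma> d' e') i'] @ B')"
    and "tangle_iso (recolor_strands (merge a b) u) (recolor_strands (merge a b) v)
       (recolor (merge a b) (A @ smoothing i d e a @ B))
       (recolor (merge a b) (A' @ smoothing i' d' e' a' @ B'))"
  shows "resolvable u v D D'"
  using assms unfolding resolvable_def by blast

section \<open>Planar moves involving a double point\<close>

lemma resolvable_exchange_left:
  assumes "tangle u [Cross Sing i, shift (i + 2) g] v"
  shows "resolvable u v [Cross Sing i, shift (i + 2) g] [shift (i + 2) g, Cross Sing i]"
proof -
  obtain l d a e b r where u: "u = l @ (d, a) # (e, b) # r" and i: "length l = i"
    and g: "slice (l @ (e, b) # (d, a) # r) (shift (i + 2) g) v"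
    using assms by (auto simp: slice_Cross)
  then obtain r' where v: "v = l @ (e, b) # (d, a) # r'" and g: "slice r g r'"
    using slice_append[of "l @ [(e, b), (d, a)]" r g v] by auto
  let ?f = "merge a b" and ?g = "shift (i + 2) g"
  let ?l = "recolor_strands ?f l" and ?r = "recolor_strands ?f r" and ?r' = "recolor_strands ?f r'"
  have sh: "slice (l @ p # q # r) ?g (l @ p # q # r')" for p q
    using slice_append[of "l @ [p, q]" r g] g i by simp
  have site: "crossing_site u v [] i [?g] d e a b"
    by (rule crossing_siteI[of _ _ l _ _ _ _ r]) (use sh i u v in simp_all)
  have site': "crossing_site u v [?g] i [] d e a b"
    by (rule crossing_siteI[of _ _ l _ _ _ _ r']) (use sh i u v in simp_all)
  have "slice (l @ [(d, a), (e, b)]) (Cross (positive d e) i) (l @ [(e, b), (d, a)])"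
    using slice.intros(3)[of l _ _ "[]"] i by simp
  from exchange_events[OF this g]
  have X: "tangle_iso u v [Cross (positive d e) i, ?g] [?g, Cross (positive d e) i]"
    using i u v by simp
  have "tangle (?l @ [(d, a), (e, a)]) (smoothing i d e a) (?l @ [(e, a), (d, a)])"
    using smoothing_tangle[of ?l d a e "[]"] i by simp
  from exchange_tangles[OF this, of ?r "[recolor_event ?f g]" ?r'] slice_recolor[OF g, of ?f]
  have I: "tangle_iso (recolor_strands ?f u) (recolor_strands ?f v)
      (smoothing i d e a @ [recolor_event ?f ?g]) (recolor_event ?f ?g # smoothing i d e a)"
    using i u v by (simp add: recolor_event_shift)
  from site site' X I show ?thesis
    by - (rule resolvableI[of _ "[]" _ "[?g]" _ "[?g]" _ "[]" _ _ d e a b d e a b positive], simp_all)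
qed

lemma resolvable_exchange_right:
  assumes "tangle u [e, Cross Sing (position e + width_out e + j)] v"
  shows "resolvable u v [e, Cross Sing (position e + width_out e + j)]
    [Cross Sing (position e + width_in e + j), e]"
proof -
  obtain w where e: "slice u e w" and X: "slice w (Cross Sing (position e + width_out e + j)) v"
    using assms by auto
  obtain k m m' r where u: "u = k @ m @ r" and w: "w = k @ m' @ r" and len: "length k = position e"
    "length m = width_in e" "length m' = width_out e" and e: "\<And>r. slice (k @ m @ r) e (k @ m' @ r)"
    using slice_local[OF e] by metis
  have "slice ((k @ m') @ r) (shift (length (k @ m')) (Cross Sing j)) v"
    using X w len by simp
  then obtain r' where "v = k @ m' @ r'" "slice r (Cross Sing j) r'"
    unfolding slice_append by auto
  then obtain l d a d' b r0 where r: "r = l @ (d, a) # (d', b) # r0" and j: "length l = j"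
    and v: "v = k @ m' @ l @ (d', b) # (d, a) # r0"
    by (auto simp: slice_Cross)
  let ?i = "position e + width_out e + j" and ?i' = "position e + width_in e + j"
  let ?f = "merge a b"
  have site: "crossing_site u v [e] ?i [] d d' a b"
    by (rule crossing_siteI[of _ _ "k @ m' @ l" _ _ _ _ r0]) (use e j u v r len in simp_all)
  have site': "crossing_site u v [] ?i' [e] d d' a b"
    by (rule crossing_siteI[of _ _ "k @ m @ l" _ _ _ _ r0])
      (use e[of "l @ (d', b) # (d, a) # r0"] j u v r len in simp_all)
  \<comment> \<open>The strands to the right of \<open>e\<close>, which carry the double point, are
    split off as the second factor of the exchange.\<close>
  have e0: "slice (k @ m) e (k @ m')"
    using e[of "[]"] by simp
  have "slice r (Cross (positive d d') j) (l @ (d', b) # (d, a) # r0)"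
    using slice.intros(3)[of l] j r by simp
  from exchange_events[OF e0 this]
  have X: "tangle_iso u v [e, Cross (positive d d') ?i] [Cross (positive d d') ?i', e]"
    using len u v by simp
  have "tangle (recolor_strands ?f r) (smoothing j d d' a) (recolor_strands ?f (l @ (d', b) # (d, a) # r0))"
    using smoothing_tangle[of "recolor_strands ?f l" d a d'] j r by simp
  from exchange_event_tangle[OF slice_recolor[OF e0] this]
  have I: "tangle_iso (recolor_strands ?f u) (recolor_strands ?f v)
      (recolor_event ?f e # smoothing ?i d d' a) (smoothing ?i' d d' a @ [recolor_event ?f e])"
    using len u v by simp
  from site site' X I show ?thesis
    by - (rule resolvableI[of _ "[e]" _ "[]" _ "[]" _ "[e]" _ _ d d' a b d d' a b positive], simp_all)
qed

text \<open>Reversing one strand changes the sign of a crossing. As a quarter turn reverses one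
  strand and turns the picture, it preserves signs.\<close>

lemma positive_opp [simp]:
  "positive e (opp d) = turn (positive d e)" "positive (opp d) e = turn (positive d e)"
  by (cases d; cases e; simp add: positive_def)+

text \<open>The quarter turn exchanges the two forms of the smoothing: one side has upright arcs,
  the other a maximum below a minimum, and they differ by a zigzag next to the remaining
  maximum.\<close>

lemma resolvable_turn_cap:
  assumes "tangle u [Cross Sing 0, Cap 1] v"
  shows "resolvable u v [Cross Sing 0, Cap 1] [Cross Sing 1, Cap 0]"
proof -
  obtain d a e b s where u: "u = (d, a) # (e, b) # (opp d, a) # s" and v: "v = (e, b) # s"
    using assms by (auto simp: tangle_simps)
  let ?f = "merge a b"
  have site: "crossing_site u v [] 0 [Cap 1] d e a b"
    by (rule crossing_siteI[of _ _ "[]" _ _ _ _ "(opp d, a) # s"]) (simp_all add: u v tangle_simps)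
  \<comment> \<open>The turned double point meets the strand of colour \<open>a\<close> from the
    other end of the maximum: on the right and with direction \<open>opp d\<close>. Hence the
    colours appear as \<open>b\<close>, \<open>a\<close>.\<close>
  have site': "crossing_site u v [] 1 [Cap 0] e (opp d) b a"
    by (rule crossing_siteI[of _ _ "[(d, a)]" _ _ _ _ s]) (simp_all add: u v tangle_simps)
  have X: "tangle_iso u v [Cross (positive d e) 0, Cap 1] [Cross (turn (positive d e)) 1, Cap 0]"
    by (rule tangle_iso_move[OF disjI1[OF turn_cap]]) (simp_all add: u v tangle_simps)
  have I: "tangle_iso (recolor_strands ?f u) (recolor_strands ?f v)
      (smoothing 0 d e a @ [Cap 1]) (smoothing 1 e (opp d) a @ [Cap 0])"
  proof (cases "d = e")
    case True
    then show ?thesis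
      using tangle_iso_step(2)[OF disjI1[OF snake_left[of "opp d" a]],
          of "recolor_strands ?f u" "[Cap 1]" 0 "[]" "recolor_strands ?f v"]
      by (simp add: u v smoothing_def tangle_simps)
  next
    case False
    then show ?thesis
      using tangle_iso_step(1)[OF disjI1[OF snake_right[of e a]],
          of "recolor_strands ?f u" "[Cap 0]" 0 "[]" "recolor_strands ?f v"]
      by (simp add: u v smoothing_def tangle_simps neq_dir_iff)
  qed
  from site site' X I show ?thesis
    by - (rule resolvableI[of _ "[]" _ "[Cap 1]" _ "[]" _ "[Cap 0]" _ _ d e a b e "opp d" b a positive],
      simp_all)
qed

lemma resolvable_turn_cup:
  assumes "tangle u [Cup 1 d b, Cross Sing 0] v"
  shows "resolvable u v [Cup 1 d b, Cross Sing 0] [Cup 0 d b, Cross Sing 1]"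
proof -
  obtain e a s where u: "u = (e, a) # s" and v: "v = (d, b) # (e, a) # (opp d, b) # s"
    using assms by (auto simp: tangle_simps)
  let ?f = "merge a b"
  have site: "crossing_site u v [Cup 1 d b] 0 [] e d a b"
    by (rule crossing_siteI[of _ _ "[]" _ _ _ _ "(opp d, b) # s"]) (simp_all add: u v tangle_simps)
  have site': "crossing_site u v [Cup 0 d b] 1 [] (opp d) e b a"
    by (rule crossing_siteI[of _ _ "[(d, b)]" _ _ _ _ s]) (simp_all add: u v tangle_simps)
  have X: "tangle_iso u v [Cup 1 d b, Cross (positive e d) 0] [Cup 0 d b, Cross (turn (positive e d)) 1]"
    by (rule tangle_iso_move[OF disjI1[OF turn_cup]]) (simp_all add: u v tangle_simps)
  have I: "tangle_iso (recolor_strands ?f u) (recolor_strands ?f v)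
      (Cup 1 d a # smoothing 0 e d a) (Cup 0 d a # smoothing 1 (opp d) e a)"
  proof (cases "d = e")
    case True
    then show ?thesis
      using tangle_iso_step(2)[OF disjI1[OF snake_right[of d a]],
          of "recolor_strands ?f u" "[]" 0 "[Cup 1 e a]" "recolor_strands ?f v"]
      by (simp add: u v smoothing_def tangle_simps)
  next
    case False
    then show ?thesis
      using tangle_iso_step(1)[OF disjI1[OF snake_left[of d a]],
          of "recolor_strands ?f u" "[]" 0 "[Cup 0 d a]" "recolor_strands ?f v"]
      by (simp add: u v smoothing_def tangle_simps neq_dir_iff)
  qed
  \<comment> \<open>Stated with the arguments of \<open>positive\<close> in the order of the first
    site; the rule \<open>positive_opp\<close> would produce \<open>positive d e\<close>
    instead.\<close>
  have sign: "positive (opp d) e = turn (positive e d)"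
    by (cases d; cases e) (simp_all add: positive_def)
  from site site' X I show ?thesis
    by - (rule resolvableI[of _ "[Cup 1 d b]" _ "[]" _ "[Cup 0 d b]" _ "[]" _ _ e d a b "opp d" e b a positive],
      simp_all add: sign del: positive_opp)
qed

section \<open>The moves \<open>R4\<close> and \<open>R5\<close>\<close>

text \<open>The strand \<open>r\<close> crosses the other two with the same \<open>k\<close>, so the
  resolved move is an instance of \<open>R3\<close> for either sign. Upright smoothings make both
  sides equal; for antiparallel ones both sides are joined to the tangle in which \<open>r\<close>
  runs between the maximum and the minimum without crossings.\<close>

lemma resolvable_R4_r:
  assumes "k \<noteq> Sing" "tangle u [Cross Sing 0, Cross k 1, Cross k 0] v"
  shows "resolvable u v [Cross Sing 0, Cross k 1, Cross k 0] [Cross k 1, Cross k 0, Cross Sing 1]"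
proof -
  obtain d a e b r s where u: "u = (d, a) # (e, b) # r # s" and v: "v = r # (e, b) # (d, a) # s"
    using assms(2) by (auto simp: tangle_simps)
  let ?f = "merge a b" and ?r = "(fst r, merge a b (snd r))" and ?s = "recolor_strands (merge a b) s"
  have site: "crossing_site u v [] 0 [Cross k 1, Cross k 0] d e a b"
    by (rule crossing_siteI[of _ _ "[]" _ _ _ _ "r # s"]; cases r) (simp_all add: u v tangle_simps)
  have site': "crossing_site u v [Cross k 1, Cross k 0] 1 [] d e a b"
    by (rule crossing_siteI[of _ _ "[r]" _ _ _ _ s]; cases r) (simp_all add: u v tangle_simps)
  have X: "tangle_iso u v [Cross (positive d e) 0, Cross k 1, Cross k 0]
      [Cross k 1, Cross k 0, Cross (positive d e) 1]"
    by (rule tangle_iso_move[OF disjI2[OF R3]]; cases r) (use assms in \<open>simp_all add: u v tangle_simps\<close>)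
  have I: "tangle_iso (recolor_strands ?f u) (recolor_strands ?f v)
      (smoothing 0 d e a @ [Cross k 1, Cross k 0]) ([Cross k 1, Cross k 0] @ smoothing 1 d e a)"
  proof (cases "d = e")
    case True
    then show ?thesis
      by (simp add: smoothing_def)
  next
    case False
    then have e: "e = opp d"
      by (simp add: neq_dir_iff)
    let ?u = "(d, a) # (opp d, a) # ?r # ?s" and ?v = "?r # (opp d, a) # (d, a) # ?s"
    have "tangle_iso ?u ?v [Cap 0, Cup 0 e a, Cross k 1, Cross k 0] [Cap 0, Cup 1 e a]"
      using tangle_iso_context[OF cup_under_strand_right[OF assms(1), of ?r ?s e a], of ?u "[Cap 0]" "[]" ?v]
      by (simp add: e tangle_simps)
    also have "tangle_iso ?u ?v \<dots> [Cross k 1, Cross k 0, Cap 1, Cup 1 e a]"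
      using tangle_iso_context[OF equivclp_sym[OF cap_under_strand_right[OF assms(1), of d a ?r ?s]],
          of ?u "[]" "[Cup 1 e a]" ?v]
      by (simp add: e tangle_simps)
    finally show ?thesis
      by (cases r) (simp add: u v e smoothing_def)
  qed
  from site site' X I show ?thesis
    by - (rule resolvableI[of _ "[]" _ "[Cross k 1, Cross k 0]" _ "[Cross k 1, Cross k 0]" _ "[]"
        _ _ d e a b d e a b positive], simp_all)
qed

lemma resolvable_R4_p:
  assumes "k \<noteq> Sing" "tangle u [Cross k 0, Cross k 1, Cross Sing 0] v"
  shows "resolvable u v [Cross k 0, Cross k 1, Cross Sing 0] [Cross Sing 1, Cross k 0, Cross k 1]"
proof -
  obtain p d a e b s where u: "u = p # (d, a) # (e, b) # s" and v: "v = (e, b) # (d, a) # p # s"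
    using assms(2) by (auto simp: tangle_simps)
  let ?f = "merge a b" and ?p = "(fst p, merge a b (snd p))" and ?s = "recolor_strands (merge a b) s"
  have site: "crossing_site u v [Cross k 0, Cross k 1] 0 [] d e a b"
    by (rule crossing_siteI[of _ _ "[]" _ _ _ _ "p # s"]; cases p) (simp_all add: u v tangle_simps)
  have site': "crossing_site u v [] 1 [Cross k 0, Cross k 1] d e a b"
    by (rule crossing_siteI[of _ _ "[p]" _ _ _ _ s]; cases p) (simp_all add: u v tangle_simps)
  have X: "tangle_iso u v [Cross k 0, Cross k 1, Cross (positive d e) 0]
      [Cross (positive d e) 1, Cross k 0, Cross k 1]"
    by (rule tangle_iso_move[OF disjI2[OF R3]]; cases p) (use assms in \<open>simp_all add: u v tangle_simps\<close>)
  have I: "tangle_iso (recolor_strands ?f u) (recolor_strands ?f v)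
      ([Cross k 0, Cross k 1] @ smoothing 0 d e a) (smoothing 1 d e a @ [Cross k 0, Cross k 1])"
  proof (cases "d = e")
    case True
    then show ?thesis
      by (simp add: smoothing_def)
  next
    case False
    then have e: "e = opp d"
      by (simp add: neq_dir_iff)
    let ?u = "?p # (d, a) # (opp d, a) # ?s" and ?v = "(opp d, a) # (d, a) # ?p # ?s"
    have "tangle_iso ?u ?v [Cross k 0, Cross k 1, Cap 0, Cup 0 e a] [Cap 1, Cup 0 e a]"
      using tangle_iso_context[OF cap_under_strand_left[OF assms(1), of ?p d a ?s],
          of ?u "[]" "[Cup 0 e a]" ?v]
      by (simp add: e tangle_simps)
    also have "tangle_iso ?u ?v \<dots> [Cap 1, Cup 1 e a, Cross k 0, Cross k 1]"
      using tangle_iso_context[OF equivclp_sym[OF cup_under_strand_left[OF assms(1), of ?p ?s e a]],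
          of ?u "[Cap 1]" "[]" ?v]
      by (simp add: e tangle_simps)
    finally show ?thesis
      by (cases p) (simp add: u v e smoothing_def)
  qed
  from site site' X I show ?thesis
    by - (rule resolvableI[of _ "[Cross k 0, Cross k 1]" _ "[]" _ "[]" _ "[Cross k 0, Cross k 1]"
        _ _ d e a b d e a b positive], simp_all)
qed

text \<open>In \<open>R4_q\<close> the resolved double point becomes the crossing \<open>l\<close>
  of \<open>R3\<close>, with \<open>k\<close> and \<open>turn k\<close> as the other two; this
  supplies the condition that excludes cyclic patterns.\<close>

lemma eq_or_eq_turn: "k \<noteq> Sing \<Longrightarrow> l \<noteq> Sing \<Longrightarrow> l = k \<or> l = turn k"
  by (cases k; cases l) auto

lemma resolvable_R4_q:
  assumes "k \<noteq> Sing" "tangle u [Cross k 0, Cross Sing 1, Cross (turn k) 0] v"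
  shows "resolvable u v [Cross k 0, Cross Sing 1, Cross (turn k) 0]
    [Cross (turn k) 1, Cross Sing 0, Cross k 1]"
proof -
  obtain d a q e b s where u: "u = (d, a) # q # (e, b) # s" and v: "v = (e, b) # q # (d, a) # s"
    using assms(2) by (auto simp: tangle_simps)
  let ?f = "merge a b" and ?q = "(fst q, merge a b (snd q))" and ?s = "recolor_strands (merge a b) s"
  have site: "crossing_site u v [Cross k 0] 1 [Cross (turn k) 0] d e a b"
    by (rule crossing_siteI[of _ _ "[q]" _ _ _ _ s]; cases q) (simp_all add: u v tangle_simps)
  have site': "crossing_site u v [Cross (turn k) 1] 0 [Cross k 1] d e a b"
    by (rule crossing_siteI[of _ _ "[]" _ _ _ _ "q # s"]; cases q) (simp_all add: u v tangle_simps)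
  have X: "tangle_iso u v [Cross k 0, Cross (positive d e) 1, Cross (turn k) 0]
      [Cross (turn k) 1, Cross (positive d e) 0, Cross k 1]"
    by (rule tangle_iso_move[OF disjI2[OF R3]]; cases q)
      (use assms eq_or_eq_turn in \<open>simp_all add: u v tangle_simps\<close>)
  have I: "tangle_iso (recolor_strands ?f u) (recolor_strands ?f v)
      ([Cross k 0] @ smoothing 1 d e a @ [Cross (turn k) 0]) ([Cross (turn k) 1] @ smoothing 0 d e a @ [Cross k 1])"
  proof (cases "d = e")
    case True
    \<comment> \<open>With equal directions and merged colours the two boundary words coincide. The
      strand \<open>?q\<close> then crosses one arc twice, and both sides reduce to the empty word
      by \<open>R2\<close>.\<close>
    let ?u = "(d, a) # ?q # (d, a) # ?s"
    have "tangle_iso ?u ?u [Cross k 0, Cross (turn k) 0] []"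
      by (rule tangle_iso_move[OF disjI2[OF R2]]) (use assms in \<open>simp_all add: tangle_simps\<close>)
    also have "tangle_iso ?u ?u [] [Cross (turn k) 1, Cross k 1]"
      using tangle_iso_step(2)[OF disjI2[OF R2[of "turn k"]], of ?u "[]" 1 "[]" ?u] assms
      by (simp add: tangle_simps)
    finally show ?thesis
      by (cases q) (simp add: u v True smoothing_def)
  next
    case False
    then have e: "e = opp d"
      by (simp add: neq_dir_iff)
    let ?u = "(d, a) # ?q # (opp d, a) # ?s" and ?v = "(opp d, a) # ?q # (d, a) # ?s"
    have "tangle_iso ?u ?v [Cross k 0, Cap 1, Cup 1 e a, Cross (turn k) 0]
        [Cross (turn k) 1, Cap 0, Cup 1 e a, Cross (turn k) 0]"
      using tangle_iso_step(1)[OF disjI1[OF turn_cap[of k]], of ?u "[]" 0 "[Cup 1 e a, Cross (turn k) 0]" ?v]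
      by (simp add: e tangle_simps)
    also have "tangle_iso ?u ?v \<dots> [Cross (turn k) 1, Cap 0, Cup 0 e a, Cross k 1]"
      using tangle_iso_step(1)[OF disjI1[OF turn_cup[of e a "turn k"]],
          of ?u "[Cross (turn k) 1, Cap 0]" 0 "[]" ?v]
      by (simp add: e tangle_simps)
    finally show ?thesis
      by (cases q) (simp add: u v e smoothing_def)
  qed
  from site site' X I show ?thesis
    by - (rule resolvableI[of _ "[Cross k 0]" _ "[Cross (turn k) 0]" _ "[Cross (turn k) 1]" _ "[Cross k 1]"
        _ _ d e a b d e a b positive], simp_all)
qed

text \<open>Resolving the double point into the crossing cancelled by \<open>k\<close> makes both sides trivial.\<close>

lemma resolvable_R5:
  assumes "k \<noteq> Sing" "tangle u [Cross Sing 0, Cross k 0] v"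
  shows "resolvable u v [Cross Sing 0, Cross k 0] [Cross k 0, Cross Sing 0]"
proof -
  obtain d a e b s where u: "u = (d, a) # (e, b) # s" and v: "v = (d, a) # (e, b) # s"
    using assms(2) by (auto simp: tangle_simps)
  let ?f = "merge a b" and ?s = "recolor_strands (merge a b) s"
  have site: "crossing_site u v [] 0 [Cross k 0] d e a b"
    by (rule crossing_siteI[of _ _ "[]" _ _ _ _ s]) (simp_all add: u v tangle_simps)
  have site': "crossing_site u v [Cross k 0] 0 [] e d b a"
    by (rule crossing_siteI[of _ _ "[]" _ _ _ _ s]) (simp_all add: u v tangle_simps)
  \<comment> \<open>Both signs depend only on whether the directions agree, so one choice yields
    \<open>turn k\<close> for either order of the strands.\<close>
  obtain \<sigma> where sign: "\<sigma> = positive \<or> \<sigma> = negative" and \<sigma>: "\<sigma> d e = turn k" "\<sigma> e d = turn k"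
    using that[of positive] that[of negative] assms(1)
    by (cases k; cases "d = e") (auto simp: positive_def negative_def)
  have "tangle_iso u v [Cross (turn k) 0, Cross k 0] []"
    using tangle_iso_step(1)[OF disjI2[OF R2[of "turn k"]], of u "[]" 0 "[]" v] assms(1)
    by (simp add: u v tangle_simps)
  also have "tangle_iso u v [] [Cross k 0, Cross (turn k) 0]"
    using tangle_iso_step(2)[OF disjI2[OF R2[of k]], of u "[]" 0 "[]" v] assms(1)
    by (simp add: u v tangle_simps)
  finally have X: "tangle_iso u v [Cross (\<sigma> d e) 0, Cross k 0] [Cross k 0, Cross (\<sigma> e d) 0]"
    by (simp add: \<sigma>)
  have I: "tangle_iso (recolor_strands ?f u) (recolor_strands ?f v)
      (smoothing 0 d e a @ [Cross k 0]) ([Cross k 0] @ smoothing 0 e d a)"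
  proof (cases "d = e")
    case True
    then show ?thesis
      by (simp add: smoothing_def)
  next
    case False
    then have e: "e = opp d"
      by (simp add: neq_dir_iff)
    let ?u = "(d, a) # (opp d, a) # ?s"
    have "tangle_iso ?u ?u [Cap 0, Cup 0 e a, Cross k 0] [Cap 0, Cup 0 d a]"
      using tangle_iso_context[OF twisted_cup[OF assms(1), of ?s d a], of ?u "[Cap 0]" "[]" ?u]
      by (simp add: e tangle_simps)
    also have "tangle_iso ?u ?u \<dots> [Cross k 0, Cap 0, Cup 0 d a]"
      using tangle_iso_context[OF equivclp_sym[OF twisted_cap[OF assms(1), of d a ?s]],
          of ?u "[]" "[Cup 0 d a]" ?u]
      by (simp add: e tangle_simps)
    finally show ?thesis
      by (simp add: u v e smoothing_def)
  qed
  from site site' X I sign show ?thesis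
    by - (rule resolvableI[of _ "[]" _ "[Cross k 0]" _ "[Cross k 0]" _ "[]" _ _ d e a b e d b a \<sigma>],
      simp_all)
qed

text \<open>Zigzags, \<open>R1\<close>, \<open>R2\<close> and \<open>R3\<close> contain no double
  point. When two double points exchange heights, only \<open>e\<close> is resolved and
  \<open>g\<close> is treated as an arbitrary event.\<close>

lemma move_resolvable:
  assumes "planar_move P Q \<or> reidemeister_move P Q" "sing_count P \<noteq> 0" "tangle u P v"
  shows "resolvable u v P Q"
  using assms(1)
proof
  assume "planar_move P Q"
  then show ?thesis
    using assms(2,3)
  proof (cases rule: planar_move.cases)
    case (exchange e g)
    show ?thesis
    proof (cases "is_sing e")
      case True
      then obtain i where "e = Cross Sing i"
        by (auto simp: is_sing_iff)
      then show ?thesis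
        using exchange assms(3) resolvable_exchange_left by auto
    next
      case False
      then have "is_sing g"
        using exchange assms(2) by (auto split: if_splits)
      then obtain j where "g = Cross Sing j"
        by (auto simp: is_sing_iff)
      then show ?thesis
        using exchange assms(3) resolvable_exchange_right by auto
    qed
  next
    case (turn_cap k)
    then show ?thesis
      using assms(2,3) resolvable_turn_cap[of u v] by (auto split: if_splits)
  next
    case (turn_cup d c k)
    then show ?thesis
      using assms(2,3) resolvable_turn_cup[of u d c v] by (auto split: if_splits)
  qed auto
next
  assume "reidemeister_move P Q"
  then show ?thesis
    using assms(2,3)
  proof (cases rule: reidemeister_move.cases)
    case (R4_r k)
    then show ?thesis
      using resolvable_R4_r assms(3) by metis
  next
    case (R4_p k)
    then show ?thesis
      using resolvable_R4_p assms(3) by metis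
  next
    case (R4_q k)
    then show ?thesis
      using resolvable_R4_q assms(3) by metis
  next
    case (R5 k)
    then show ?thesis
      using resolvable_R5 assms(3) by metis
  qed auto
qed

section \<open>Double points away from the move\<close>

text \<open>A resolved crossing leaves the boundary words of the pattern unchanged, and a smoothing
  changes them only by the merge, under which the isotopy between \<open>R\<close> and
  \<open>R'\<close> is stable.\<close>

lemma resolvable_below:
  assumes "tangle_iso s t R R'" "tangle s R t" "tangle s R' t"
    and "tangle u (A @ [Cross Sing i] @ A') s" "tangle t B v"
  shows "resolvable u v ((A @ [Cross Sing i] @ A') @ R @ B) ((A @ [Cross Sing i] @ A') @ R' @ B)"
proof -
  obtain d e a b where site: "crossing_site u s A i A' d e a b"
    using assms(4) crossing_site_cross by blast
  have sites: "crossing_site u v A i (A' @ T @ B) d e a b" if "tangle s T t" for T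
    using site assms(5) that unfolding crossing_site_def tangle_append by blast
  have X: "tangle_iso u v ((A @ [Cross (positive d e) i] @ A') @ R @ B)
      ((A @ [Cross (positive d e) i] @ A') @ R' @ B)"
    by (rule tangle_iso_context[OF assms(1) crossing_site_tangle[OF site] assms(5)])
  note I = tangle_iso_context[OF tangle_iso_recolor[OF assms(1)] crossing_site_smoothing[OF site]
      tangle_recolor[OF assms(5)]]
  from sites[OF assms(2)] sites[OF assms(3)] X I show ?thesis
    by - (rule resolvableI[of _ A _ "A' @ R @ B" _ A _ "A' @ R' @ B" _ _ d e a b d e a b positive],
      simp_all)
qed

lemma resolvable_above:
  assumes "tangle_iso s t R R'" "tangle s R t" "tangle s R' t"
    and "tangle u A s" "tangle t (B @ [Cross Sing i] @ B') v"
  shows "resolvable u v (A @ R @ B @ [Cross Sing i] @ B') (A @ R' @ B @ [Cross Sing i] @ B')"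
proof -
  obtain d e a b where site: "crossing_site t v B i B' d e a b"
    using assms(5) crossing_site_cross by blast
  have sites: "crossing_site u v (A @ T @ B) i B' d e a b" if "tangle s T t" for T
    using site assms(4) that unfolding crossing_site_def tangle_append by blast
  have X: "tangle_iso u v (A @ R @ B @ [Cross (positive d e) i] @ B')
      (A @ R' @ B @ [Cross (positive d e) i] @ B')"
    by (rule tangle_iso_context[OF assms(1,4) crossing_site_tangle[OF site]])
  note I = tangle_iso_context[OF tangle_iso_recolor[OF assms(1)] tangle_recolor[OF assms(4)]
      crossing_site_smoothing[OF site]]
  from sites[OF assms(2)] sites[OF assms(3)] X I show ?thesis
    by - (rule resolvableI[of _ "A @ R @ B" _ B' _ "A @ R' @ B" _ B' _ _ d e a b d e a b positive],
      simp_all)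
qed

lemma equivclp_move_recolor: "equivclp move D D' \<Longrightarrow> equivclp move (recolor f D) (recolor f D')"
  using tangle_iso_recolor[of "[]" "[]" D D' f] by (simp add: move_eq_tangle_move)

section \<open>Invariance\<close>

locale skein =
  fixes F br :: "diagram \<Rightarrow> ratfun"
  assumes AJ: "AJ_invariant F" and skein: "skein_extension F br"
begin

text \<open>The order of the quantifiers matters: \<open>x\<close>, \<open>y\<close>,
  \<open>z\<close> are fixed by the sign before the site is given, so two sites resolved with the
  same sign share their coefficients.\<close>

lemma br_resolve:
  assumes "\<sigma> = positive \<or> \<sigma> = negative"
  obtains x y z where "\<And>A i B d e a b. crossing_site [] [] A i B d e a b \<Longrightarrow>
    br (A @ [Cross Sing i] @ B) = x * br (A @ [Cross (\<sigma> d e) i] @ B)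
      + y * br (recolor (merge a b) (A @ smoothing i d e a @ B))
      + z * br (recolor (merge a b) (A @ [Cross (\<sigma> d e) i] @ B))"
proof -
  let ?S = "\<lambda>A i B d e a b. Site A i B d e a b"
  have smooth: "I_smooth (?S A i B d e a b) = recolor (merge a b) (A @ smoothing i d e a @ B)"
    and merge: "merge_colors (?S A i B d e a b) D = recolor (merge a b) D" for A i B d e a b D
    by (simp_all add: smoothing_def merge_def[abs_def])
  have site: "is_site (?S A i B d e a b)" if "crossing_site [] [] A i B d e a b" for A i B d e a b
    using that by (simp add: crossing_site_def)
  have pos: "is_site S \<Longrightarrow> br (V_sing S) = 1 / var_w * br (X_plus S) + 1 / var_t * br (I_smooth S)
      + 1 / (var_t * var_w) * br (merge_colors S (X_plus S))"
    and neg: "is_site S \<Longrightarrow> br (V_sing S) = var_w * br (X_minus S) + var_t * br (I_smooth S)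
      + var_t * var_w * br (merge_colors S (X_minus S))" for S
    using skein unfolding skein_extension_def by blast+
  from assms show thesis
    using that[of "1 / var_w" "1 / var_t" "1 / (var_t * var_w)"]
      that[of var_w var_t "var_t * var_w"]
      pos[OF site, unfolded smooth merge V_sing.simps X_plus.simps]
      neg[OF site, unfolded smooth merge V_sing.simps X_minus.simps] by blast
qed

lemma br_classical_isotopic:
  assumes "classical D" "classical D'" "isotopic D D'"
  shows "br D = br D'"
  using assms AJ skein unfolding AJ_invariant_def skein_extension_def isotopic_def by metis

text \<open>Resolving the recoloured diagram at the same site gives the recoloured resolutions of
  \<open>D\<close>. Classical diagrams are isotopic along the empty chain of moves, as
  \<open>isotopic\<close> allows for \<open>\<beta>\<close>.\<close>

lemma br_recolor:
  assumes "is_diagram D" "inj_on \<beta> (colors D)"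
  shows "br (recolor \<beta> D) = br D"
  using assms
proof (induction "sing_count D" arbitrary: D rule: less_induct)
  case less
  show ?case
  proof (cases "sing_count D = 0")
    case True
    then have "classical D" "classical (recolor \<beta> D)"
      by (simp_all flip: sing_count_eq_0)
    moreover have "isotopic D (recolor \<beta> D)"
      unfolding isotopic_def using less.prems is_diagram_recolor by (auto intro!: exI[of _ \<beta>])
    ultimately show ?thesis
      using br_classical_isotopic by metis
  next
    case False
    then obtain A i B where D: "D = A @ [Cross Sing i] @ B"
      using sing_count_pos by blast
    then obtain d e a b where site: "crossing_site [] [] A i B d e a b"
      using less.prems crossing_site_cross unfolding is_diagram_def by blast
    note site_rc = crossing_site_recolor[OF site, of \<beta>, simplified]
    let ?X = "A @ [Cross (positive d e) i] @ B" and ?I = "A @ smoothing i d e a @ B"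
    have ab: "a \<in> colors A" "b \<in> colors A"
      using crossing_site_colors[OF site] .
    have sub: "colors ?X \<subseteq> colors D" "colors ?I \<subseteq> colors D"
      using ab colors_smoothing[of i d e a] colors_Cons[of _ B] colors_Cross D by auto
    \<comment> \<open>Injectivity enters here: \<open>\<beta> c = \<beta> b\<close> forces
      \<open>c = b\<close>, so both orders merge the same colours.\<close>
    have comm: "recolor (merge (\<beta> a) (\<beta> b)) (recolor \<beta> E) = recolor \<beta> (recolor (merge a b) E)"
      if "colors E \<subseteq> colors D" for E
      unfolding recolor_recolor
      by (rule recolor_cong) (use that less.prems(2) ab D in \<open>auto simp: merge_def inj_on_def\<close>)
    have inj: "inj_on \<beta> (colors (recolor (merge a b) E))" if "colors E \<subseteq> colors D" for E
      by (rule inj_on_subset[OF less.prems(2)])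
        (use that ab D in \<open>auto simp: colors_recolor merge_def\<close>)
    have X: "is_diagram ?X"
      using crossing_site_tangle[OF site] by (simp add: is_diagram_def)
    have I: "is_diagram (recolor (merge a b) ?I)"
      using crossing_site_smoothing[OF site] by (simp add: is_diagram_def)
    have "br (recolor \<beta> ?X) = br ?X"
      by (rule less.hyps) (use D X inj_on_subset[OF less.prems(2) sub(1)] in simp_all)
    moreover have "br (recolor (merge (\<beta> a) (\<beta> b)) (recolor \<beta> ?I)) = br (recolor (merge a b) ?I)"
      unfolding comm[OF sub(2)] by (rule less.hyps) (use D I inj[OF sub(2)] in simp_all)
    moreover have "br (recolor (merge (\<beta> a) (\<beta> b)) (recolor \<beta> ?X)) = br (recolor (merge a b) ?X)"
      unfolding comm[OF sub(1)]
      by (rule less.hyps) (use D is_diagram_recolor[OF X, of "merge a b"] inj[OF sub(1)] in simp_all)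
    moreover obtain x y z where res: "\<And>A i B d e a b. crossing_site [] [] A i B d e a b \<Longrightarrow>
      br (A @ [Cross Sing i] @ B) = x * br (A @ [Cross (positive d e) i] @ B)
      + y * br (recolor (merge a b) (A @ smoothing i d e a @ B))
      + z * br (recolor (merge a b) (A @ [Cross (positive d e) i] @ B))"
      using br_resolve[of positive] by blast
    ultimately show ?thesis
      using res[OF site] res[OF site_rc] D by simp
  qed
qed

text \<open>After merging \<open>b\<close> into \<open>a\<close> the colour \<open>b\<close> no
  longer occurs, unless it equals \<open>a\<close>. Renaming \<open>a\<close> to \<open>b\<close> is
  then injective on the colours in use.\<close>

lemma br_merge_swap:
  assumes "is_diagram (recolor (merge a b) D)"
  shows "br (recolor (merge b a) D) = br (recolor (merge a b) D)"
proof -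
  have "recolor (merge b a) D = recolor (merge b a) (recolor (merge a b) D)"
    unfolding recolor_recolor by (rule recolor_cong) (auto simp: merge_def)
  also have "br \<dots> = br (recolor (merge a b) D)"
    by (rule br_recolor[OF assms]) (auto simp: colors_recolor merge_def inj_on_def)
  finally show ?thesis .
qed

lemma br_sing_eqI:
  assumes IH: "\<And>D D'. sing_count D < sing_count (A @ [Cross Sing i] @ B) \<Longrightarrow> is_diagram D \<Longrightarrow>
      equivclp move D D' \<Longrightarrow> br D = br D'"
    and site: "crossing_site [] [] A i B d e a b" and site': "crossing_site [] [] A' i' B' d' e' a' b'"
    and colors: "(a', b') = (a, b) \<or> (a', b') = (b, a)"
    and sign: "\<sigma> = positive \<or> \<sigma> = negative"
    and X: "equivclp move (A @ [Cross (\<sigma> d e) i] @ B) (A' @ [Cross (\<sigma> d' e') i'] @ B')"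
    and I: "equivclp move (recolor (merge a b) (A @ smoothing i d e a @ B))
      (recolor (merge a b) (A' @ smoothing i' d' e' a' @ B'))"
  shows "br (A @ [Cross Sing i] @ B) = br (A' @ [Cross Sing i'] @ B')"
proof -
  let ?X = "A @ [Cross (\<sigma> d e) i] @ B" and ?I = "A @ smoothing i d e a @ B"
  let ?X' = "A' @ [Cross (\<sigma> d' e') i'] @ B'" and ?I' = "A' @ smoothing i' d' e' a' @ B'"
  have \<sigma>: "\<sigma> d e \<noteq> Sing"
    using sign by auto
  have X_diag: "is_diagram ?X"
    using crossing_site_tangle[OF site] by (simp add: is_diagram_def)
  have I_diag: "is_diagram (recolor (merge a b) ?I)"
    using crossing_site_smoothing[OF site] by (simp add: is_diagram_def)
  have swap: "br (recolor (merge a' b') E) = br (recolor (merge a b) E)"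
    if "is_diagram (recolor (merge a b) E)" for E
    using that br_merge_swap colors by auto
  have merge_diag: "is_diagram (recolor (merge a b) ?X')" "is_diagram (recolor (merge a b) ?I')"
    using equivclp_move_invariants[OF X X_diag] is_diagram_recolor
      equivclp_move_invariants[OF I I_diag] by blast+
  have "br ?X = br ?X'"
    by (rule IH[OF _ X_diag X]) (use \<sigma> in simp)
  \<comment> \<open>Merging colours throughout the chain \<open>X\<close> joins the merged
    crossings; \<open>swap\<close> accounts for a second site that merges the other way.\<close>
  moreover have "br (recolor (merge a b) ?X) = br (recolor (merge a' b') ?X')"
    unfolding swap[OF merge_diag(1)]
    by (rule IH[OF _ is_diagram_recolor[OF X_diag] equivclp_move_recolor[OF X]]) (use \<sigma> in simp)
  moreover have "br (recolor (merge a b) ?I) = br (recolor (merge a' b') ?I')"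
    unfolding swap[OF merge_diag(2)] by (rule IH[OF _ I_diag I]) simp
  moreover obtain x y z where res: "\<And>A i B d e a b. crossing_site [] [] A i B d e a b \<Longrightarrow>
      br (A @ [Cross Sing i] @ B) = x * br (A @ [Cross (\<sigma> d e) i] @ B)
      + y * br (recolor (merge a b) (A @ smoothing i d e a @ B))
      + z * br (recolor (merge a b) (A @ [Cross (\<sigma> d e) i] @ B))"
    using br_resolve[OF sign] by blast
  ultimately show ?thesis
    using res[OF site] res[OF site'] by simp
qed

lemma br_resolvable:
  assumes IH: "\<And>D D'. sing_count D < sing_count (A @ map (shift (length l)) P @ B) \<Longrightarrow>
      is_diagram D \<Longrightarrow> equivclp move D D' \<Longrightarrow> br D = br D'"
    and A: "tangle [] A (l @ x)" and B: "tangle (l @ y) B []" and "resolvable x y P Q"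
  shows "br (A @ map (shift (length l)) P @ B) = br (A @ map (shift (length l)) Q @ B)"
proof -
  obtain P1 i P2 Q1 j Q2 d e a b d' e' a' b' \<sigma> where
    PQ: "P = P1 @ [Cross Sing i] @ P2" "Q = Q1 @ [Cross Sing j] @ Q2"
    and site: "crossing_site x y P1 i P2 d e a b" "crossing_site x y Q1 j Q2 d' e' a' b'"
    and colors: "(a', b') = (a, b) \<or> (a', b') = (b, a)"
    and sign: "\<sigma> = positive \<or> \<sigma> = negative"
    and X: "tangle_iso x y (P1 @ [Cross (\<sigma> d e) i] @ P2) (Q1 @ [Cross (\<sigma> d' e') j] @ Q2)"
    and I: "tangle_iso (recolor_strands (merge a b) x) (recolor_strands (merge a b) y)
      (recolor (merge a b) (P1 @ smoothing i d e a @ P2))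
      (recolor (merge a b) (Q1 @ smoothing j d' e' a' @ Q2))"
    using assms(4) unfolding resolvable_def by blast
  let ?f = "merge a b" and ?sh = "map (shift (length l))"
  note X' = tangle_iso_context[OF tangle_iso_shift[OF X, of l] A B, folded move_eq_tangle_move]
  \<comment> \<open>Recolouring keeps the number of strands, so the pattern has the same offset in
    the recoloured context.\<close>
  have "tangle [] (recolor ?f A) (recolor_strands ?f l @ recolor_strands ?f x)"
    "tangle (recolor_strands ?f l @ recolor_strands ?f y) (recolor ?f B) []"
    using tangle_recolor[OF A, of ?f] tangle_recolor[OF B, of ?f] by simp_all
  note I' = tangle_iso_context[OF tangle_iso_shift[OF I] this, folded move_eq_tangle_move]
  have "br ((A @ ?sh P1) @ [Cross Sing (length l + i)] @ (?sh P2 @ B)) =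
    br ((A @ ?sh Q1) @ [Cross Sing (length l + j)] @ (?sh Q2 @ B))"
    by (rule br_sing_eqI[OF _ crossing_site_context[OF site(1) A B]
          crossing_site_context[OF site(2) A B] colors sign])
      (use IH PQ X' I' in \<open>simp_all add: recolor_map_shift\<close>)
  then show ?thesis
    by (simp add: PQ)
qed

lemma br_move:
  assumes IH: "\<And>E E'. sing_count E < sing_count D \<Longrightarrow> is_diagram E \<Longrightarrow> equivclp move E E' \<Longrightarrow> br E = br E'"
    and "move D D'"
  shows "br D = br D'"
proof -
  obtain A P Q B n s t where PQ: "planar_move P Q \<or> reidemeister_move P Q"
    and A: "tangle [] A s" and P: "tangle s (map (shift n) P) t" and Q: "tangle s (map (shift n) Q) t"
    and B: "tangle t B []" and D: "D = A @ map (shift n) P @ B" and D': "D' = A @ map (shift n) Q @ B"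
    using assms(2) unfolding move_def by blast
  have iso: "tangle_iso s t (map (shift n) P) (map (shift n) Q)"
    using tangle_iso_step(1)[OF PQ, of s "[]" n "[]" t] P Q by simp
  show ?thesis
  proof (cases "sing_count P = 0")
    case False
    \<comment> \<open>The first event of the pattern bounds the offset: its position is at least
      \<open>n\<close> and at most the number of strands in \<open>s\<close>, so \<open>s\<close>
      can be split after \<open>n\<close> strands.\<close>
    then obtain e P' where "P = e # P'"
      by (cases P) auto
    then obtain s' where "slice s (shift n e) s'"
      using P by auto
    moreover have "n \<le> position (shift n e)"
      by (cases e) auto
    ultimately have "n \<le> length s"
      using slice_length le_trans by blast
    then obtain l x where s: "s = l @ x" and n: "n = length l"
      by (metis append_take_drop_id length_take min.absorb2)
    obtain y where t: "t = l @ y" and P: "tangle x P y"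
      using P unfolding s n tangle_shift by blast
    show ?thesis
      using br_resolvable[of A l P B x y Q] move_resolvable[OF PQ False P] A B IH
      unfolding D D' n s t by blast
  next
    case P0: True
    show ?thesis
    proof (cases "sing_count A = 0 \<and> sing_count B = 0")
      case True
      then have "classical D" "classical D'"
        using P0 sing_count_move[OF assms(2)] by (simp_all add: D flip: sing_count_eq_0)
      moreover have "isotopic D D'"
        using move_is_diagram[OF assms(2)] assms(2)
        by (auto simp: isotopic_def intro!: exI[of _ id] r_into_equivclp)
      ultimately show ?thesis
        using br_classical_isotopic by blast
    next
      case False
      then consider (below) "sing_count A \<noteq> 0" | (above) "sing_count B \<noteq> 0"
        by auto
      then have "resolvable [] [] D D'"
      proof cases
        case below
        then obtain A1 i A2 where "A = A1 @ [Cross Sing i] @ A2"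
          using sing_count_pos by blast
        then show ?thesis
          using resolvable_below[OF iso P Q, of "[]" A1 i A2 B "[]"] A B D D' by simp
      next
        case above
        then obtain B1 i B2 where "B = B1 @ [Cross Sing i] @ B2"
          using sing_count_pos by blast
        then show ?thesis
          using resolvable_above[OF iso P Q, of "[]" A B1 i B2 "[]"] A B D D' by simp
      qed
      \<comment> \<open>The double point lies outside the pattern, so all of \<open>D\<close> is
        taken as the tangle, with empty contexts.\<close>
      then show ?thesis
        using br_resolvable[of "[]" "[]" D "[]" "[]" "[]" D'] IH by simp
    qed
  qed
qed

end

theorem theorem1:
  fixes F br :: "diagram \<Rightarrow> ratfun" and D1 D2 :: diagram
  assumes "AJ_invariant F"
    and "skein_extension F br"
    and "isotopic D1 D2"
  shows "br D1 = br D2"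
proof -
  interpret skein F br
    using assms(1,2) by unfold_locales
  have eq: "br D = br D'" if "is_diagram D" "equivclp move D D'" for D D'
    using that
  proof (induction "sing_count D" arbitrary: D D' rule: less_induct)
    case less
    from less.prems(2) show ?case
    proof (induction rule: equivclp_induct)
      case (step E E')
      have count: "sing_count E = sing_count D" "sing_count E' = sing_count D"
        using equivclp_move_invariants[OF step(1) less.prems(1)] step(2) sing_count_move by auto
      have IH: "br G = br G'" if "sing_count G < sing_count D" "is_diagram G" "equivclp move G G'" for G G'
        using less.hyps that by blast
      \<comment> \<open>A step of the equivalence closure may be a move in either direction, hence
        the two instances.\<close>
      have "br E = br E'"
        using step(2) br_move[of E E'] br_move[of E' E] IH count by auto
      then show ?case
        using step by simp
    qed simp
  qed
  obtain \<beta> where "is_diagram D1" "inj_on \<beta> (colors D1)" "equivclp move (recolor \<beta> D1) D2"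
    using assms(3) unfolding isotopic_def by blast
  then show ?thesis
    using br_recolor[of D1 \<beta>] eq[of "recolor \<beta> D1" D2] is_diagram_recolor by simp
qed

end
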